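(* There are Type I Hausdorff non-regular spaces $R,X$, with $R$ connected, such that the following holds: (a) $R$ is an $\mathbb{L}_{\ge 0}$-direction in itself which is not true: any continuous function $R\to\mathbb{L}_{\ge 0}$ is constant. (b) $X$ contains two clubs $D_1,D_2$ such that $D_1$ is a true $\mathbb{L}_{\ge 0}$-direction in $X$ but not an $R$-direction in $X$, and $D_2$ is a true $R$-direction in $X$ but not an $\mathbb{L}_{\ge 0}$-direction in $X$.
   Context: All functions are continuous unless otherwise specified. A (Hausdorff) space $X$ is Type I if $X=\bigcup_{\alpha<\omega_1}X_\alpha$ with each $X_\alpha$ open, $\overline{X_\alpha}$ Lindelöf, and $\overline{X_\alpha}\subset X_\beta$ whenever $\alpha<\beta$; Type I spaces are always assumed non-Lindelöf. A subset of a Type I space is bounded if it is contained in some $X_\alpha$, otherwise unbounded; a function into a Type I space is (un)bounded if its range is. Club means closed and unbounded. $\mathbb{L}_{\ge 0}$ is the closed long ray $\omega_1\times[0,1)$ with the lexicographic order topology (with $X_\alpha=[0,\alpha)$). Let $X,Y$ be Type I spaces and $D\subset X$ be club. $D$ is a $Y$-direction in $X$ if for every continuous $f:X\to Y$ with $f$ unbounded on $D$, $f$ is unbounded on any club subset of $D$ as well. If there exists a continuous $f:X\to Y$ which is unbounded on $D$, the $Y$-direction $D$ is said to be true. $X$ is a $Y$-direction in itself if $D=X$ is a $Y$-direction in $X$. *)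

theory Defs
  imports "HOL-Analysis.Analysis" "HOL-Library.Countable_Set_Type"
begin

section \<open>The first uncountable ordinal\<close>

text \<open>
  The type \<open>omega1\<close> is the set of ordinals below \<open>\<omega>\<^sub>1\<close>, realised as the field of the
  cardinal successor of \<open>\<aleph>\<^sub>0\<close>.  The lemmas \<open>uncountable_omega1\<close> and \<open>countable_lessThan_omega1\<close>
  determine it up to isomorphism among the well-ordered types.
\<close>

typedef omega1 = "Field (cardSuc natLeq)"
proof -
  have "infinite (Field (cardSuc natLeq))"
    using cardSuc_finite[OF natLeq_Card_order] by (simp add: Field_natLeq)
  then show ?thesis
    by (metis all_not_in_conv finite.emptyI)
qed

instantiation omega1 :: linorder
begin

definition less_eq_omega1 :: "omega1 \<Rightarrow> omega1 \<Rightarrow> bool" where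
  "a \<le> b \<longleftrightarrow> (Rep_omega1 a, Rep_omega1 b) \<in> cardSuc natLeq"

definition less_omega1 :: "omega1 \<Rightarrow> omega1 \<Rightarrow> bool" where
  "(a :: omega1) < b \<longleftrightarrow> a \<le> b \<and> a \<noteq> b"

instance
proof
  have wo: "Well_order (cardSuc natLeq)"
    using cardSuc_Card_order[OF natLeq_Card_order] by (simp add: card_order_on_def)
  then have lo: "Linear_order (cardSuc natLeq)"
    by (auto simp: well_order_on_def)
  have rf: "Refl (cardSuc natLeq)" and tr: "trans (cardSuc natLeq)"
    and an: "antisym (cardSuc natLeq)" and tot: "Total (cardSuc natLeq)"
    using lo by (auto simp: linear_order_on_def partial_order_on_def preorder_on_def)
  fix x y z :: omega1
  show refl: "x \<le> x" for x :: omega1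
    using rf Rep_omega1[of x] by (auto simp: less_eq_omega1_def refl_on_def)
  show anti: "x = y" if "x \<le> y" "y \<le> x" for x y :: omega1
    using that an unfolding less_eq_omega1_def by (metis antisymD Rep_omega1_inject)
  show "(x < y) = (x \<le> y \<and> \<not> y \<le> x)"
    using anti refl by (auto simp: less_omega1_def)
  show "x \<le> z" if "x \<le> y" "y \<le> z"
    using that tr by (auto simp: less_eq_omega1_def dest: transD)
  show "x \<le> y \<or> y \<le> x"
    using tot refl Rep_omega1[of x] Rep_omega1[of y]
    by (cases "x = y") (auto simp: less_eq_omega1_def total_on_def Rep_omega1_inject)
qed

end

instance omega1 :: wellorder
proof
  have wf: "wf (cardSuc natLeq - Id)"
    using cardSuc_Card_order[OF natLeq_Card_order] by (simp add: card_order_on_def well_order_on_def)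
  fix P :: "omega1 \<Rightarrow> bool" and a :: omega1
  assume step: "\<And>x. (\<And>y. y < x \<Longrightarrow> P y) \<Longrightarrow> P x"
  have "wf (inv_image (cardSuc natLeq - Id) Rep_omega1)"
    using wf by (rule wf_inv_image)
  then show "P a"
  proof (induction a rule: wf_induct_rule)
    case (less x)
    show ?case
      by (rule step, rule less)
        (auto simp: inv_image_def less_omega1_def less_eq_omega1_def Rep_omega1_inject)
  qed
qed

lemma uncountable_omega1:
  includes cardinal_syntax
  shows "uncountable (UNIV :: omega1 set)"
proof
  assume c: "countable (UNIV :: omega1 set)"
  have "Rep_omega1 ` UNIV = Field (cardSuc natLeq)"
    using type_definition.Rep_range[OF type_definition_omega1] .
  with c have "countable (Field (cardSuc natLeq))"
    by (metis countable_image)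
  then have "|Field (cardSuc natLeq)| \<le>o natLeq"
    by (simp add: countable_card_le_natLeq)
  moreover have "|Field (cardSuc natLeq)| =o cardSuc natLeq"
    by (simp add: card_of_Field_ordIso cardSuc_Card_order natLeq_Card_order)
  ultimately have "cardSuc natLeq \<le>o natLeq"
    by (meson ordIso_iff_ordLeq ordLeq_transitive)
  then show False
    using cardSuc_greater[OF natLeq_Card_order] not_ordLess_ordLeq by blast
qed

lemma countable_lessThan_omega1:
  includes cardinal_syntax
  shows "countable {..<a :: omega1}"
proof -
  let ?U = "underS (cardSuc natLeq) (Rep_omega1 a)"
  have "|?U| <o cardSuc natLeq"
    using card_of_underS[OF cardSuc_Card_order[OF natLeq_Card_order] Rep_omega1] .
  then have "|?U| \<le>o natLeq"
    by (simp add: cardSuc_ordLeq_ordLess natLeq_Card_order card_of_Card_order)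
  then have "countable ?U"
    by (simp add: countable_card_le_natLeq)
  moreover have "Rep_omega1 ` {..<a} \<subseteq> ?U"
    by (auto simp: underS_def less_omega1_def less_eq_omega1_def Rep_omega1_inject)
  ultimately have "countable (Rep_omega1 ` {..<a})"
    by (rule countable_subset[rotated])
  then show ?thesis
    by (rule countable_image_inj_on) (simp add: inj_on_def Rep_omega1_inject)
qed


section \<open>The closed long ray\<close>

typedef long_ray = "UNIV \<times> {0..<1} :: (omega1 \<times> real) set"
  by force

instantiation long_ray :: linorder
begin

definition less_long_ray :: "long_ray \<Rightarrow> long_ray \<Rightarrow> bool" where
  "x < y \<longleftrightarrow> fst (Rep_long_ray x) < fst (Rep_long_ray y) \<or>
     fst (Rep_long_ray x) = fst (Rep_long_ray y) \<and> snd (Rep_long_ray x) < snd (Rep_long_ray y)"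

definition less_eq_long_ray :: "long_ray \<Rightarrow> long_ray \<Rightarrow> bool" where
  "(x :: long_ray) \<le> y \<longleftrightarrow> x < y \<or> x = y"

instance
proof
  fix x y z :: long_ray
  show "(x < y) = (x \<le> y \<and> \<not> y \<le> x)"
    by (auto simp: less_eq_long_ray_def less_long_ray_def)
  show "x \<le> x"
    by (simp add: less_eq_long_ray_def)
  show "x \<le> z" if "x \<le> y" "y \<le> z"
    using that by (auto simp: less_eq_long_ray_def less_long_ray_def)
  show "x = y" if "x \<le> y" "y \<le> x"
    using that by (auto simp: less_eq_long_ray_def less_long_ray_def)
  show "x \<le> y \<or> y \<le> x"
    by (auto simp: less_eq_long_ray_def less_long_ray_def Rep_long_ray_inject[symmetric] prod_eq_iff)
qed

end

instantiation long_ray :: linorder_topology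
begin

definition open_long_ray :: "long_ray set \<Rightarrow> bool" where
  "open_long_ray = generate_topology (range (\<lambda>a. {..<a}) \<union> range (\<lambda>a. {a<..}))"

instance
  by standard (rule open_long_ray_def)

end

abbreviation L\<^sub>0 :: "long_ray topology" where
  "L\<^sub>0 \<equiv> euclidean"

definition long_ray_stage :: "omega1 \<Rightarrow> long_ray set" where
  "long_ray_stage \<alpha> = {..<Abs_long_ray (\<alpha>, 0)}"


section \<open>Type I spaces\<close>

text \<open>
  A Type I space is represented by its topology \<open>X\<close> together with the family of stages \<open>A \<alpha>\<close>
  (written \<open>X\<^sub>\<alpha>\<close> in the literature).  The choice of the family is immaterial for boundedness, see
  \<open>bounded_wrt_indep\<close> below.
\<close>

definition type_I :: "'a topology \<Rightarrow> (omega1 \<Rightarrow> 'a set) \<Rightarrow> bool" where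
  "type_I X A \<longleftrightarrow>
     Hausdorff_space X \<and>
     topspace X = (\<Union>\<alpha>. A \<alpha>) \<and>
     (\<forall>\<alpha>. openin X (A \<alpha>)) \<and>
     (\<forall>\<alpha>. Lindelof_space (subtopology X (X closure_of A \<alpha>))) \<and>
     (\<forall>\<alpha> \<beta>. \<alpha> < \<beta> \<longrightarrow> X closure_of A \<alpha> \<subseteq> A \<beta>) \<and>
     \<not> Lindelof_space X"

definition bounded_wrt :: "(omega1 \<Rightarrow> 'a set) \<Rightarrow> 'a set \<Rightarrow> bool" where
  "bounded_wrt A S \<longleftrightarrow> (\<exists>\<alpha>. S \<subseteq> A \<alpha>)"

definition club :: "'a topology \<Rightarrow> (omega1 \<Rightarrow> 'a set) \<Rightarrow> 'a set \<Rightarrow> bool" where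
  "club X A C \<longleftrightarrow> closedin X C \<and> \<not> bounded_wrt A C"

text \<open>
  \<open>direction X A Y B D\<close>: the set \<open>D\<close> is a \<open>Y\<close>-direction in \<open>X\<close>, where \<open>A\<close> and \<open>B\<close> are the stages
  of \<open>X\<close> and \<open>Y\<close>.  Since \<open>D\<close> is closed, the clubs of \<open>X\<close> that lie in \<open>D\<close> are exactly the club
  subsets of \<open>D\<close>.
\<close>

definition direction ::
  "'a topology \<Rightarrow> (omega1 \<Rightarrow> 'a set) \<Rightarrow> 'b topology \<Rightarrow> (omega1 \<Rightarrow> 'b set) \<Rightarrow> 'a set \<Rightarrow> bool" where
  "direction X A Y B D \<longleftrightarrow>
     club X A D \<and>
     (\<forall>f. continuous_map X Y f \<and> \<not> bounded_wrt B (f ` D) \<longrightarrow>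
        (\<forall>C. club X A C \<and> C \<subseteq> D \<longrightarrow> \<not> bounded_wrt B (f ` C)))"

definition true_direction ::
  "'a topology \<Rightarrow> (omega1 \<Rightarrow> 'a set) \<Rightarrow> 'b topology \<Rightarrow> (omega1 \<Rightarrow> 'b set) \<Rightarrow> 'a set \<Rightarrow> bool" where
  "true_direction X A Y B D \<longleftrightarrow>
     direction X A Y B D \<and> (\<exists>f. continuous_map X Y f \<and> \<not> bounded_wrt B (f ` D))"

lemma countable_bounded_omega1:
  assumes "countable (S :: omega1 set)"
  obtains \<gamma> where "\<And>\<alpha>. \<alpha> \<in> S \<Longrightarrow> \<alpha> < \<gamma>"
proof -
  have "countable (\<Union>\<alpha>\<in>S. insert \<alpha> {..<\<alpha>})"
    using assms countable_lessThan_omega1 by auto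
  then obtain \<gamma> where "\<gamma> \<notin> (\<Union>\<alpha>\<in>S. insert \<alpha> {..<\<alpha>})"
    using uncountable_omega1 by (metis UNIV_eq_I)
  then show ?thesis
    using that[of \<gamma>] by (metis UN_iff insert_iff lessThan_iff linorder_less_linear)
qed

lemma bounded_wrt_mono_stage:
  assumes A: "type_I X A" and B: "type_I X B"
  shows "\<exists>\<beta>. A \<alpha> \<subseteq> B \<beta>"
proof -
  let ?K = "X closure_of A \<alpha>"
  have sub: "A \<alpha> \<subseteq> ?K"
    using A by (auto simp: type_I_def intro!: closure_of_subset)
  have "Lindelof_space (subtopology X ?K)"
    using A by (simp add: type_I_def)
  moreover have "\<forall>U\<in>range (\<lambda>\<beta>. ?K \<inter> B \<beta>). openin (subtopology X ?K) U"
    using B by (auto simp: type_I_def openin_subtopology_Int2)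
  moreover have "\<Union> (range (\<lambda>\<beta>. ?K \<inter> B \<beta>)) = topspace (subtopology X ?K)"
    using B by (auto simp: type_I_def)
  ultimately obtain \<V> where V: "countable \<V>" "\<V> \<subseteq> range (\<lambda>\<beta>. ?K \<inter> B \<beta>)"
    "\<Union>\<V> = topspace (subtopology X ?K)"
    unfolding Lindelof_space_def by meson
  then obtain S where S: "countable S" "\<V> = (\<lambda>\<beta>. ?K \<inter> B \<beta>) ` S"
    by (metis countable_subset_image)
  obtain \<gamma> where \<gamma>: "\<And>\<beta>. \<beta> \<in> S \<Longrightarrow> \<beta> < \<gamma>"
    using countable_bounded_omega1[OF S(1)] by blast
  have "B \<beta> \<subseteq> B \<gamma>" if "\<beta> \<in> S" for \<beta>
  proof -
    have "B \<beta> \<subseteq> X closure_of B \<beta>"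
      using B by (auto simp: type_I_def intro!: closure_of_subset)
    then show ?thesis
      using B \<gamma>[OF that] unfolding type_I_def by blast
  qed
  moreover have "?K \<subseteq> \<Union>\<V>"
    using V(3) closure_of_subset_topspace[of X "A \<alpha>"] by auto
  ultimately have "?K \<subseteq> B \<gamma>"
    using S(2) by blast
  with sub show ?thesis by blast
qed

lemma bounded_wrt_indep:
  assumes "type_I X A" and "type_I X B"
  shows "bounded_wrt A S \<longleftrightarrow> bounded_wrt B S"
  using bounded_wrt_mono_stage[OF assms] bounded_wrt_mono_stage[OF assms(2,1)]
  unfolding bounded_wrt_def by (meson order_trans)

end

theory Submission
  imports Defs "HOL-Number_Theory.Cong" "HOL-Computational_Algebra.Primes"
begin

text \<open>
  Let \<open>R\<close> be a long ray in which the intervals \<open>[0, 1)\<close> are replaced by countable pieces of the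
  Golomb space, where the closures of any two nonempty open sets meet.  Continuous maps from \<open>R\<close>
  to a Urysohn space are then constant; this makes \<open>R\<close> connected and non-regular.  Conversely,
  a continuous map from the long ray to \<open>R\<close> is constant, because the stages of \<open>R\<close> are countable.
  So for \<open>X = R \<times> L\<^sub>0\<close> every map from \<open>X\<close> to a factor depends on the coordinate in that
  factor only.  Any two clubs of \<open>R\<close> meet, and likewise for \<open>L\<^sub>0\<close>.  Hence the part of \<open>X\<close> on
  one side of the diagonal, where one coordinate controls the other, is a direction for the
  controlling factor; it is none for the other factor, since it contains an unbounded slice
  on which the other coordinate is fixed.
\<close>

section \<open>Urysohn separation\<close>

text \<open>Two demands pull against each other. Countable stages make maps from the long ray into
  \<open>R\<close> constant: the image of a compact interval is a countable connected compact
  Hausdorff space, and Urysohn's lemma leaves it a single point. The same lemma shows that a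
  countable connected Hausdorff piece with two points is never regular, which excludes ordinary
  pieces and suggests the Golomb space. Countability also pays for the product: a closed stage of
  \<open>X\<close> is covered by countably many slices, whereas a product of Lindelof spaces need
  not be Lindelof. In each copy 2 plays the left end of [0, 1) and the absent 1 the right end, a
  role taken over by the base point of the next copy. Defining the topology by retractions instead
  of neighbourhoods reduces the Hausdorff property to a power of the Golomb space and lets
  convergence to base points be checked one coordinate at a time. That convergence makes clubs
  meet.\<close>

definition urysohn_separated :: "'a topology \<Rightarrow> bool" where
  "urysohn_separated Z \<longleftrightarrow> (\<forall>x\<in>topspace Z. \<forall>y\<in>topspace Z. x \<noteq> y \<longrightarrow>
     (\<exists>U V. openin Z U \<and> openin Z V \<and> x \<in> U \<and> y \<in> V \<and> disjnt (Z closure_of U) (Z closure_of V)))"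

lemma urysohn_separatedE:
  assumes "urysohn_separated Z" "x \<in> topspace Z" "y \<in> topspace Z" "x \<noteq> y"
  obtains U V where "openin Z U" "openin Z V" "x \<in> U" "y \<in> V"
    "disjnt (Z closure_of U) (Z closure_of V)"
proof -
  have "\<exists>U V. openin Z U \<and> openin Z V \<and> x \<in> U \<and> y \<in> V \<and> disjnt (Z closure_of U) (Z closure_of V)"
    using assms unfolding urysohn_separated_def by simp
  then show ?thesis
    using that by auto
qed

lemma urysohn_separated_imp_Hausdorff:
  assumes "urysohn_separated Z" shows "Hausdorff_space Z"
  unfolding Hausdorff_space_def
proof (intro allI impI)
  fix x y assume xy: "x \<in> topspace Z \<and> y \<in> topspace Z \<and> x \<noteq> y"
  obtain U V where UV: "openin Z U" "openin Z V" "x \<in> U" "y \<in> V"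
    "disjnt (Z closure_of U) (Z closure_of V)"
    using urysohn_separatedE[OF assms] xy by metis
  have "U \<subseteq> Z closure_of U" "V \<subseteq> Z closure_of V"
    using UV by (auto intro!: closure_of_subset openin_subset)
  then have "disjnt U V"
    using UV(5) unfolding disjnt_def by blast
  then show "\<exists>U V. openin Z U \<and> openin Z V \<and> x \<in> U \<and> y \<in> V \<and> disjnt U V"
    using UV by (intro exI[of _ U] exI[of _ V]) simp
qed

text \<open>Regularity is applied twice: it gives \<open>x\<close> a closed neighbourhood
  \<open>K\<close> missing \<open>y\<close>, then \<open>y\<close> one missing \<open>K\<close>. The
  contrapositive detects non-regularity of the ray.\<close>

lemma regular_Hausdorff_imp_urysohn_separated:
  assumes "regular_space Z" "Hausdorff_space Z" shows "urysohn_separated Z"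
  unfolding urysohn_separated_def
proof (intro ballI impI)
  fix x y assume xy: "x \<in> topspace Z" "y \<in> topspace Z" "x \<noteq> y"
  have reg: "\<exists>U K. openin Z U \<and> closedin Z K \<and> a \<in> U \<and> U \<subseteq> K \<and> K \<subseteq> W"
    if "openin Z W" "a \<in> W" for W a
    using assms(1) that unfolding neighbourhood_base_of_closedin[symmetric] neighbourhood_base_of
    by simp
  have "openin Z (topspace Z - {y})"
    using Hausdorff_imp_t1_space[OF assms(2)] by (simp add: t1_space_openin_delete_alt)
  then obtain U K where U: "openin Z U" "closedin Z K" "x \<in> U" "U \<subseteq> K" "K \<subseteq> topspace Z - {y}"
    using reg[of "topspace Z - {y}" x] xy by auto
  obtain V K' where V: "openin Z V" "closedin Z K'" "y \<in> V" "V \<subseteq> K'" "K' \<subseteq> topspace Z - K"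
    using reg[of "topspace Z - K" y] xy U by auto
  have "Z closure_of U \<subseteq> K" "Z closure_of V \<subseteq> K'"
    by (simp_all add: U V closure_of_minimal)
  then have "disjnt (Z closure_of U) (Z closure_of V)"
    using V(5) unfolding disjnt_def by blast
  then show "\<exists>U V. openin Z U \<and> openin Z V \<and> x \<in> U \<and> y \<in> V \<and> disjnt (Z closure_of U) (Z closure_of V)"
    using U V by (intro exI[of _ U] exI[of _ V]) simp
qed

text \<open>With discrete targets, constancy of maps into separated spaces turns into
  connectedness.\<close>

lemma urysohn_separated_discrete: "urysohn_separated (discrete_topology S)"
  unfolding urysohn_separated_def
proof (intro ballI impI)
  fix x y assume "x \<in> topspace (discrete_topology S)" "y \<in> topspace (discrete_topology S)" "x \<noteq> y"
  then show "\<exists>U V. openin (discrete_topology S) U \<and> openin (discrete_topology S) V \<and> x \<in> U \<and> y \<in> V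
      \<and> disjnt (discrete_topology S closure_of U) (discrete_topology S closure_of V)"
    by (intro exI[of _ "{x}"] exI[of _ "{y}"]) (simp_all add: disjnt_def discrete_topology_closure_of)
qed

section \<open>The Golomb space\<close>

text \<open>Golomb's topology on the positive integers, with coprime progressions as basis. Starting
  the progression at the tested point itself loses nothing: from each of its members, a coprime
  progression continues as a coprime one.\<close>

definition golomb_open :: "nat set \<Rightarrow> bool" where
  "golomb_open U \<longleftrightarrow> 0 \<notin> U \<and> (\<forall>a\<in>U. \<exists>b>0. coprime a b \<and> (\<forall>n. a + b * n \<in> U))"

lemma golomb_openD:
  assumes "golomb_open U" "a \<in> U"
  obtains b where "b > 0" "coprime a b" "\<And>n. a + b * n \<in> U"
  using assms unfolding golomb_open_def by blast

definition golomb :: "nat topology" where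
  "golomb = topology golomb_open"

lemma istopology_golomb: "istopology golomb_open"
  unfolding istopology_def
proof (intro conjI allI impI)
  fix U V assume U: "golomb_open U" and V: "golomb_open V"
  show "golomb_open (U \<inter> V)"
    unfolding golomb_open_def
  proof (intro conjI ballI)
    fix a assume a: "a \<in> U \<inter> V"
    obtain b where b: "b > 0" "coprime a b" "\<And>n. a + b * n \<in> U"
      using golomb_openD[OF U] a by (metis IntD1)
    obtain c where c: "c > 0" "coprime a c" "\<And>n. a + c * n \<in> V"
      using golomb_openD[OF V] a by (metis IntD2)
    have "a + (b * c) * n \<in> U \<inter> V" for n
      using b(3)[of "c * n"] c(3)[of "b * n"] by (simp add: ac_simps)
    then show "\<exists>b>0. coprime a b \<and> (\<forall>n. a + b * n \<in> U \<inter> V)"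
      using b c by (intro exI[of _ "b * c"]) auto
  qed (use U in \<open>simp add: golomb_open_def\<close>)
next
  fix \<U> assume "\<forall>U\<in>\<U>. golomb_open U"
  then show "golomb_open (\<Union>\<U>)"
    unfolding golomb_open_def by (meson Union_iff)
qed

lemma openin_golomb: "openin golomb U \<longleftrightarrow> golomb_open U"
  by (simp add: golomb_def istopology_golomb topology_inverse')

lemma topspace_golomb: "topspace golomb = {1..}"
proof -
  have "golomb_open {1..}"
    by (auto simp: golomb_open_def intro!: exI[of _ 1])
  moreover have "U \<subseteq> {1..}" if "golomb_open U" for U
    using that by (metis atLeast_iff golomb_open_def less_one linorder_le_less_linear subsetI)
  ultimately show ?thesis
    unfolding topspace_def openin_golomb by blast
qed

lemma golomb_open_progression:
  assumes "a > 0" "b > 0" "coprime a b" shows "golomb_open (range (\<lambda>n. a + b * n))"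
  unfolding golomb_open_def
proof (intro conjI ballI)
  fix x assume "x \<in> range (\<lambda>n. a + b * n)"
  then obtain n where n: "x = a + b * n" by blast
  have "coprime x b"
    using assms(3) n by (metis coprime_iff_gcd_eq_1 gcd.commute gcd_add_mult mult.commute add.commute)
  moreover have "x + b * m \<in> range (\<lambda>n. a + b * n)" for m
    by (rule image_eqI[of _ _ "n + m"]) (auto simp: n algebra_simps)
  ultimately show "\<exists>c>0. coprime x c \<and> (\<forall>m. x + c * m \<in> range (\<lambda>n. a + b * n))"
    using assms(2) by blast
qed (use assms in auto)

lemma Hausdorff_golomb: "Hausdorff_space golomb"
  unfolding Hausdorff_space_def
proof (intro allI impI)
  fix x y assume "x \<in> topspace golomb \<and> y \<in> topspace golomb \<and> x \<noteq> y"
  then have xy: "x > 0" "y > 0" "x \<noteq> y"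
    by (auto simp: topspace_golomb)
  \<comment> \<open>A prime above both numbers is coprime to each and leaves them in different
    residue classes.\<close>
  obtain p where p: "prime p" "p > x + y"
    using bigger_prime by blast
  have "\<not> p dvd x" "\<not> p dvd y"
    using p xy by (auto dest: dvd_imp_le)
  then have cop: "coprime x p" "coprime y p"
    using p(1) by (simp_all add: prime_imp_coprime coprime_commute)
  have "x + p * m \<noteq> y + p * n" for m n
  proof
    assume "x + p * m = y + p * n"
    then have "(x + p * m) mod p = (y + p * n) mod p" by simp
    then show False using p xy by simp
  qed
  then have "disjnt (range (\<lambda>n. x + p * n)) (range (\<lambda>n. y + p * n))"
    by (auto simp: disjnt_def)
  moreover have "x \<in> range (\<lambda>n. x + p * n)" "y \<in> range (\<lambda>n. y + p * n)"
    by (intro image_eqI[of _ _ 0]; simp)+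
  moreover have "p > 0" using p by simp
  ultimately show "\<exists>U V. openin golomb U \<and> openin golomb V \<and> x \<in> U \<and> y \<in> V \<and> disjnt U V"
    by (intro exI[of _ "range (\<lambda>n. x + p * n)"] exI[of _ "range (\<lambda>n. y + p * n)"])
      (simp add: openin_golomb golomb_open_progression xy cop)
qed

text \<open>Let \<open>b\<close> be the step of a progression inside \<open>U\<close>. A basic
  neighbourhood of a multiple \<open>m\<close> of \<open>b\<close> has a step coprime to
  \<open>m\<close>, hence to \<open>b\<close>, and the Chinese remainder theorem makes the two
  progressions meet. So every positive multiple of \<open>b\<close> lies in the closure of
  \<open>U\<close>.\<close>

lemma golomb_closure_contains_multiples:
  assumes "golomb_open U" "U \<noteq> {}"
  obtains b where "b > 0" "\<And>m V. \<lbrakk>b dvd m; golomb_open V; m \<in> V\<rbrakk> \<Longrightarrow> U \<inter> V \<noteq> {}"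
proof -
  obtain a where "a \<in> U" using assms by blast
  then obtain b where b: "b > 0" "\<And>n. a + b * n \<in> U"
    using golomb_openD[OF assms(1)] by metis
  have "U \<inter> V \<noteq> {}" if mV: "b dvd m" "golomb_open V" "m \<in> V" for m V
  proof -
    obtain c where c: "c > 0" "coprime m c" "\<And>n. m + c * n \<in> V"
      using golomb_openD[OF mV(2,3)] by metis
    have "coprime b c"
      using c(2) mV(1) by (metis coprime_commute coprime_divisors dvd_refl)
    then obtain x where x: "[x = a] (mod b)" "[x = m] (mod c)"
      using binary_chinese_remainder_nat by blast
    \<comment> \<open>Progressions run upwards only, so the solution is shifted by a multiple of
      \<open>b * c\<close> until it reaches both starting points.\<close>
    define y where "y = x + b * c * (a + m)"
    have "1 * (a + m) \<le> (b * c) * (a + m)"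
      using b c by (intro mult_right_mono) (auto simp: Suc_le_eq)
    then have "a + m \<le> y"
      unfolding y_def by (simp add: trans_le_add2)
    then have ge: "a \<le> y" "m \<le> y"
      by simp_all
    have "y = x + (c * (a + m)) * b" "y = x + (b * (a + m)) * c"
      by (simp_all add: y_def algebra_simps)
    then have "[y = a] (mod b)" "[y = m] (mod c)"
      using x unfolding cong_def by (metis mod_mult_self1)+
    then obtain i j where "y = i * b + a" "y = j * c + m"
      unfolding cong_le_nat[OF ge(1)] cong_le_nat[OF ge(2)] by metis
    then have "y \<in> U" "y \<in> V"
      using b(2)[of i] c(3)[of j] by (simp_all add: ac_simps)
    then show ?thesis by blast
  qed
  with b show ?thesis using that by blast
qed

text \<open>The point \<open>1\<close> is left out because the Golomb ray is glued from copies without it.\<close>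

lemma continuous_map_golomb_const:
  assumes f: "continuous_map (subtopology golomb {2..}) Z f" and Z: "urysohn_separated Z"
    and xy: "x \<ge> 2" "y \<ge> 2"
  shows "f x = f y"
proof (rule ccontr)
  assume ne: "f x \<noteq> f y"
  let ?K = "subtopology golomb {2..}"
  have top: "topspace ?K = {2..}"
    by (auto simp: topspace_golomb)
  have openK: "openin golomb {2..}"
  proof -
    have "{2..} = topspace golomb - {1}"
      by (auto simp: topspace_golomb)
    then show ?thesis
      using Hausdorff_imp_t1_space[OF Hausdorff_golomb] by (simp add: t1_space_openin_delete_alt)
  qed
  have pre: "golomb_open {k \<in> {2..}. f k \<in> W}" if "openin Z W" for W
  proof -
    have "openin ?K {k \<in> topspace ?K. f k \<in> W}"
      using f that openin_continuous_map_preimage by blast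
    then show ?thesis
      using openK openin_open_subtopology openin_golomb top by metis
  qed
  have fim: "f k \<in> topspace Z" if "k \<ge> 2" for k
    using f that top unfolding continuous_map_def Pi_iff by auto
  obtain U V where UV: "openin Z U" "openin Z V" "f x \<in> U" "f y \<in> V"
    "disjnt (Z closure_of U) (Z closure_of V)"
    using urysohn_separatedE[OF Z fim[OF xy(1)] fim[OF xy(2)] ne] by metis
  obtain b where b: "b > 0"
    "\<And>m W. \<lbrakk>b dvd m; golomb_open W; m \<in> W\<rbrakk> \<Longrightarrow> {k \<in> {2..}. f k \<in> U} \<inter> W \<noteq> {}"
    using golomb_closure_contains_multiples[OF pre[OF UV(1)]] UV(3) xy by auto
  obtain c where c: "c > 0"
    "\<And>m W. \<lbrakk>c dvd m; golomb_open W; m \<in> W\<rbrakk> \<Longrightarrow> {k \<in> {2..}. f k \<in> V} \<inter> W \<noteq> {}"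
    using golomb_closure_contains_multiples[OF pre[OF UV(2)]] UV(4) xy by auto
  \<comment> \<open>A common multiple of both steps lies in both closures; the factor 2 keeps it off
    the point 1, which is outside the domain.\<close>
  define m where "m = b * c * 2"
  have m: "m \<ge> 2" "b dvd m" "c dvd m"
    using b(1) c(1) by (auto simp: m_def)
  have "f m \<in> Z closure_of U" "f m \<in> Z closure_of V"
    unfolding in_closure_of using fim[OF m(1)] b(2)[OF m(2) pre] c(2)[OF m(3) pre] m(1) by blast+
  with UV(5) show False
    unfolding disjnt_def by blast
qed

section \<open>Clubs in Type I spaces\<close>

lemma omega1_greater: obtains \<gamma> where "\<alpha> < (\<gamma> :: omega1)"
  using countable_bounded_omega1[of "{\<alpha>}"] by auto

text \<open>Countable sets of countable ordinals are bounded, so a least strict upper bound exists;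
  for an increasing sequence it is the limit.\<close>

lemma omega1_limit:
  fixes b :: "nat \<Rightarrow> omega1"
  obtains l where "\<And>k. b k < l" "\<And>\<gamma>. \<gamma> < l \<Longrightarrow> \<exists>k. \<gamma> \<le> b k"
proof -
  have "countable (range b)" by simp
  then obtain u where "\<And>\<alpha>. \<alpha> \<in> range b \<Longrightarrow> \<alpha> < u"
    by (rule countable_bounded_omega1) blast
  then have u: "b k < u" for k by simp
  define l where "l = (LEAST l. \<forall>k. b k < l)"
  have ub: "\<forall>k. b k < l"
    unfolding l_def by (rule LeastI[of "\<lambda>l. \<forall>k. b k < l" u]) (simp add: u)
  have lub: "\<exists>k. \<gamma> \<le> b k" if "\<gamma> < l" for \<gamma>
    using not_less_Least[of \<gamma> "\<lambda>l. \<forall>k. b k < l"] that unfolding l_def[symmetric] by (auto simp: not_less)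
  show ?thesis
    by (rule that[of l]) (simp_all add: ub lub)
qed

lemma type_I_sub_closure: "type_I X A \<Longrightarrow> A \<alpha> \<subseteq> X closure_of A \<alpha>"
  unfolding type_I_def by (intro closure_of_subset openin_subset) blast

lemma type_I_closure_sub: "type_I X A \<Longrightarrow> \<alpha> < \<beta> \<Longrightarrow> X closure_of A \<alpha> \<subseteq> A \<beta>"
  by (simp add: type_I_def)

lemma type_I_mono:
  assumes "type_I X A" "\<alpha> \<le> \<beta>" shows "A \<alpha> \<subseteq> A \<beta>"
proof (cases "\<alpha> = \<beta>")
  case False
  then show ?thesis
    using type_I_sub_closure[OF assms(1)] type_I_closure_sub[OF assms(1), of \<alpha> \<beta>] assms(2) by force
qed simp

lemma type_I_exhaust:
  assumes "type_I X A" "x \<in> topspace X" obtains \<alpha> where "x \<in> A \<alpha>"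
  using assms unfolding type_I_def by auto

lemma type_I_stage_subset: "type_I X A \<Longrightarrow> A \<alpha> \<subseteq> topspace X"
  by (auto simp: type_I_def)

lemma countable_cover_bounded:
  assumes mono: "\<And>\<alpha> \<beta>. \<alpha> \<le> \<beta> \<Longrightarrow> A \<alpha> \<subseteq> A \<beta>"
    and \<V>: "countable \<V>" "\<V> \<subseteq> range A"
  shows "bounded_wrt A (\<Union>\<V>)"
proof -
  obtain S where S: "countable S" "\<V> = A ` S"
    using \<V> by (metis countable_subset_image)
  obtain \<gamma> where "\<And>\<alpha>. \<alpha> \<in> S \<Longrightarrow> \<alpha> < \<gamma>"
    using countable_bounded_omega1[OF S(1)] by blast
  then have "\<Union>\<V> \<subseteq> A \<gamma>"
    using S(2) mono by (metis UN_least less_imp_le)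
  then show ?thesis
    unfolding bounded_wrt_def by blast
qed

text \<open>The stages form an open cover, and countably many of them lie in a single one.\<close>

lemma Lindelof_imp_bounded:
  assumes X: "type_I X A" and K: "Lindelof_space (subtopology X K)" "K \<subseteq> topspace X"
  shows "bounded_wrt A K"
proof -
  have "\<forall>U\<in>range A. openin X U" "K \<subseteq> \<Union>(range A)"
    using X K(2) by (auto simp: type_I_def)
  then obtain \<V> where "countable \<V>" "\<V> \<subseteq> range A" "K \<subseteq> \<Union>\<V>"
    using K(1) unfolding Lindelof_space_subtopology_subset[OF K(2)] by meson
  with countable_cover_bounded[of A \<V>] type_I_mono[OF X] show ?thesis
    unfolding bounded_wrt_def by (metis order_trans)
qed

text \<open>A countable union of stages is bounded, so unboundedness of the space excludes the
  Lindelof property; it is the easier condition to verify in concrete spaces.\<close>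

lemma type_I_intro:
  assumes "Hausdorff_space X" and cov: "topspace X = (\<Union>\<alpha>. A \<alpha>)" and op: "\<And>\<alpha>. openin X (A \<alpha>)"
    and "\<And>\<alpha>. Lindelof_space (subtopology X (X closure_of A \<alpha>))"
    and cl: "\<And>\<alpha> \<beta>. \<alpha> < \<beta> \<Longrightarrow> X closure_of A \<alpha> \<subseteq> A \<beta>"
    and unb: "\<not> bounded_wrt A (topspace X)"
  shows "type_I X A"
proof -
  have "A \<alpha> \<subseteq> X closure_of A \<alpha>" for \<alpha>
    by (simp add: closure_of_subset op openin_subset)
  then have mono: "A \<alpha> \<subseteq> A \<beta>" if "\<alpha> \<le> \<beta>" for \<alpha> \<beta>
    using cl that by (cases "\<alpha> = \<beta>") (simp, metis order_trans order_le_imp_less_or_eq)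
  have "\<not> Lindelof_space X"
  proof
    assume "Lindelof_space X"
    then obtain \<V> where "countable \<V>" "\<V> \<subseteq> range A" "\<Union>\<V> = topspace X"
      using Lindelof_spaceD[of X "range A"] op cov by (metis rangeE)
    with countable_cover_bounded[of A \<V>] mono unb show False
      by metis
  qed
  with assms(1-5) show ?thesis
    unfolding type_I_def by simp
qed

text \<open>A stage equal to the whole space would have the whole space as its closure, which is
  Lindelof.\<close>

lemma type_I_unbounded:
  assumes "type_I X A" shows "\<not> bounded_wrt A (topspace X)"
proof
  assume "bounded_wrt A (topspace X)"
  then obtain \<alpha> where "topspace X \<subseteq> A \<alpha>"
    unfolding bounded_wrt_def by blast
  then have "X closure_of A \<alpha> = topspace X"
    using type_I_sub_closure[OF assms, of \<alpha>] closure_of_subset_topspace[of X "A \<alpha>"] by blast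
  with assms show False
    unfolding type_I_def by (metis subtopology_topspace)
qed

lemma type_I_outside:
  assumes "type_I X A" obtains x where "x \<in> topspace X" "x \<notin> A \<alpha>"
  using type_I_unbounded[OF assms] unfolding bounded_wrt_def by blast

text \<open>Interlacing two clubs produces a sequence whose limit lies in both.\<close>

lemma clubs_meet:
  assumes X: "type_I X A" and C: "club X A C" "club X A C'"
    and lim: "\<And>b x l. \<lbrakk>\<And>k. b k < l; \<And>\<gamma>. \<gamma> < l \<Longrightarrow> \<exists>k. \<forall>n\<ge>k. \<gamma> < b n;
      \<And>k. x k \<in> A (b (Suc k)) - A (b k)\<rbrakk> \<Longrightarrow> \<exists>y. limitin X x y sequentially"
  shows "C \<inter> C' \<noteq> {}"
proof -
  define E where "E n = (if even n then C else C')" for n :: nat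
  have E: "closedin X (E n)" "\<not> bounded_wrt A (E n)" for n
    using C by (auto simp: E_def club_def)
  have step: "\<exists>x \<gamma>. \<beta> < \<gamma> \<and> x \<in> E n \<and> x \<in> A \<gamma> - A \<beta>" for n \<beta>
  proof -
    obtain x where x: "x \<in> E n" "x \<notin> A \<beta>"
      using E(2)[of n] unfolding bounded_wrt_def by blast
    then obtain \<gamma> where \<gamma>: "x \<in> A \<gamma>"
      using type_I_exhaust[OF X] E(1) closedin_subset by (metis subsetD)
    then have "\<beta> < \<gamma>"
      using type_I_mono[OF X] x(2) by (metis linorder_not_less subsetD)
    with x \<gamma> show ?thesis by blast
  qed
  \<comment> \<open>With pairs, a single choice function takes an index and a level to a point
    together with a level above it.\<close>
  have "\<forall>p. \<exists>q. snd p < snd q \<and> fst q \<in> E (fst p) \<and> fst q \<in> A (snd q) - A (snd p)"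
    using step by simp
  from choice[OF this] obtain h where h: "\<forall>p. snd p < snd (h p) \<and> fst (h p) \<in> E (fst p) \<and>
      fst (h p) \<in> A (snd (h p)) - A (snd p)"
    by blast
  define f g where "f n \<beta> = fst (h (n, \<beta>))" and "g n \<beta> = snd (h (n, \<beta>))" for n \<beta>
  have fg: "\<beta> < g n \<beta>" "f n \<beta> \<in> E n" "f n \<beta> \<in> A (g n \<beta>) - A \<beta>" for n \<beta>
    using h by (simp_all add: f_def g_def)
  \<comment> \<open>Any level can start the recursion, hence \<open>undefined\<close>.\<close>
  define b where "b = rec_nat (undefined :: omega1) g"
  have b_Suc: "b (Suc n) = g n (b n)" for n
    by (simp add: b_def)
  have mono: "strict_mono b"
    by (simp add: strict_mono_Suc_iff b_Suc fg(1))
  define x where "x n = f n (b n)" for n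
  obtain l where l: "\<And>k. b k < l" "\<And>\<gamma>. \<gamma> < l \<Longrightarrow> \<exists>k. \<gamma> \<le> b k"
    using omega1_limit by blast
  have "\<exists>k. \<forall>n\<ge>k. \<gamma> < b n" if \<gamma>: "\<gamma> < l" for \<gamma>
  proof -
    obtain k where k: "\<gamma> \<le> b k" using l(2)[OF \<gamma>] by blast
    have "\<gamma> < b n" if "n \<ge> Suc k" for n
      using strict_monoD[OF mono, of k n] that k by simp
    then show ?thesis by blast
  qed
  then obtain y where y: "limitin X x y sequentially"
    using lim[of b l x] l(1) fg(3) by (auto simp: x_def b_Suc)
  have "limitin X (x \<circ> (\<lambda>k. 2 * k)) y sequentially"
    by (rule limitin_subsequence[OF _ y]) (simp add: strict_mono_def)
  moreover have "\<forall>k. (x \<circ> (\<lambda>k. 2 * k)) k \<in> C"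
    using fg(2)[of "2 * _"] by (simp add: x_def E_def)
  ultimately have "y \<in> C"
    using C(1) by (auto simp: club_def intro: limitin_closedin)
  have "limitin X (x \<circ> (\<lambda>k. Suc (2 * k))) y sequentially"
    by (rule limitin_subsequence[OF _ y]) (simp add: strict_mono_def)
  moreover have "\<forall>k. (x \<circ> (\<lambda>k. Suc (2 * k))) k \<in> C'"
    using fg(2)[of "Suc (2 * _)"] by (simp add: x_def E_def)
  ultimately have "y \<in> C'"
    using C(2) by (auto simp: club_def intro: limitin_closedin)
  with \<open>y \<in> C\<close> show ?thesis by blast
qed

text \<open>Induction on the level: a fibre inherits the value of its base point, and the base
  point, being a limit of earlier levels, lies in the closed set where \<open>f\<close> takes the
  value \<open>c\<close>. Only the least level has no earlier one, so the hypothesis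
  \<open>cl\<close> asks for some \<open>\<alpha> < \<beta>\<close>. Both rays are handled this
  way.\<close>

lemma const_of_const_on_fibres:
  fixes idx :: "'a \<Rightarrow> omega1"
  assumes f: "continuous_map X Z f" and Z: "Hausdorff_space Z"
    and fib: "\<And>x y. \<lbrakk>x \<in> topspace X; y \<in> topspace X; idx x = idx y\<rbrakk> \<Longrightarrow> f x = f y"
    and base: "\<And>\<beta>. base \<beta> \<in> topspace X \<and> idx (base \<beta>) = \<beta>"
    and cl: "\<And>\<alpha> \<beta>. \<alpha> < \<beta> \<Longrightarrow> base \<beta> \<in> X closure_of {x \<in> topspace X. idx x < \<beta>}"
    and xy: "x \<in> topspace X" "y \<in> topspace X"
  shows "f x = f y"
proof -
  define o0 where "o0 = (LEAST \<alpha> :: omega1. True)"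
  have o0: "o0 \<le> \<alpha>" for \<alpha>
    unfolding o0_def by (rule Least_le) simp
  define c where "c = f (base o0)"
  have c: "c \<in> topspace Z"
    using f base unfolding c_def continuous_map_def by auto
  have "f (base \<beta>) = c" for \<beta>
  proof (induction \<beta> rule: less_induct)
    case (less \<beta>)
    show ?case
    proof (cases "\<beta> = o0")
      case False
      then have "o0 < \<beta>" using o0 by (simp add: order_less_le)
      have "{x \<in> topspace X. idx x < \<beta>} \<subseteq> {x \<in> topspace X. f x \<in> {c}}"
      proof safe
        fix z assume "z \<in> topspace X" "idx z < \<beta>"
        then show "f z = c"
          using fib[of z "base (idx z)"] base[of "idx z"] less[of "idx z"] by simp
      qed
      moreover have "closedin X {x \<in> topspace X. f x \<in> {c}}"
        using f c Z by (intro closedin_continuous_map_preimage[OF f])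
          (simp add: closedin_Hausdorff_sing_eq)
      ultimately have "base \<beta> \<in> {x \<in> topspace X. f x \<in> {c}}"
        using cl[OF \<open>o0 < \<beta>\<close>] closure_of_minimal by (metis (no_types, lifting) subsetD)
      then show ?thesis by simp
    qed (simp add: c_def)
  qed
  then have "f z = c" if "z \<in> topspace X" for z
    using fib[OF that, of "base (idx z)"] base[of "idx z"] by simp
  with xy show ?thesis by simp
qed

section \<open>Directions in products\<close>

text \<open>Stated through projections and slices so that \<open>X\<close> may live on a coded
  carrier. The conditions are symmetric in the factors, so one direction argument serves both sides
  of the diagonal.\<close>

locale type_I_product =
  fixes X :: "'x topology" and XA :: "omega1 \<Rightarrow> 'x set"
    and Y :: "'y topology" and A :: "omega1 \<Rightarrow> 'y set"
    and W :: "'w topology" and B :: "omega1 \<Rightarrow> 'w set"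
    and fstX :: "'x \<Rightarrow> 'y" and sndX :: "'x \<Rightarrow> 'w" and pair :: "'y \<Rightarrow> 'w \<Rightarrow> 'x"
  assumes Y: "type_I Y A" and W: "type_I W B"
    and stage: "\<And>\<alpha>. XA \<alpha> = {x \<in> topspace X. fstX x \<in> A \<alpha> \<and> sndX x \<in> B \<alpha>}"
    and cont_fst: "continuous_map X Y fstX" and cont_snd: "continuous_map X W sndX"
    and pair: "\<And>y w. \<lbrakk>y \<in> topspace Y; w \<in> topspace W\<rbrakk> \<Longrightarrow>
      pair y w \<in> topspace X \<and> fstX (pair y w) = y \<and> sndX (pair y w) = w"
    and pair_collapse: "\<And>x. x \<in> topspace X \<Longrightarrow> pair (fstX x) (sndX x) = x"
    and cont_left: "\<And>w. w \<in> topspace W \<Longrightarrow> continuous_map Y X (\<lambda>y. pair y w)"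
    and cont_right: "\<And>y. y \<in> topspace Y \<Longrightarrow> continuous_map W X (pair y)"
begin

lemma swap: "type_I_product X XA W B Y A sndX fstX (\<lambda>w y. pair y w)"
  by unfold_locales
    (use Y W cont_fst cont_snd pair pair_collapse cont_left cont_right in \<open>auto simp: stage\<close>)

lemma fstX_in: "x \<in> topspace X \<Longrightarrow> fstX x \<in> topspace Y"
  using continuous_map_image_subset_topspace[OF cont_fst] by blast

lemma sndX_in: "x \<in> topspace X \<Longrightarrow> sndX x \<in> topspace W"
  using continuous_map_image_subset_topspace[OF cont_snd] by blast

lemma Hausdorff_product: "Hausdorff_space X"
proof (rule Hausdorff_space_injective_preimage)
  show "Hausdorff_space (prod_topology Y W)"
    using Y W by (simp add: Hausdorff_space_prod_topology type_I_def)
  show "continuous_map X (prod_topology Y W) (\<lambda>x. (fstX x, sndX x))"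
    using cont_fst cont_snd by (simp add: continuous_map_paired)
  show "inj_on (\<lambda>x. (fstX x, sndX x)) (topspace X)"
    using pair_collapse by (intro inj_onI) (metis prod.inject)
qed

lemma closure_stage_subset:
  "X closure_of XA \<alpha> \<subseteq> {x \<in> topspace X. fstX x \<in> Y closure_of A \<alpha> \<and> sndX x \<in> W closure_of B \<alpha>}"
proof -
  have "X closure_of XA \<alpha> \<subseteq> {x \<in> topspace X. fstX x \<in> Y closure_of A \<alpha>}"
    using type_I_sub_closure[OF Y, of \<alpha>]
    by (intro closure_of_minimal closedin_continuous_map_preimage[OF cont_fst]) (auto simp: stage)
  moreover have "X closure_of XA \<alpha> \<subseteq> {x \<in> topspace X. sndX x \<in> W closure_of B \<alpha>}"
    using type_I_sub_closure[OF W, of \<alpha>]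
    by (intro closure_of_minimal closedin_continuous_map_preimage[OF cont_snd]) (auto simp: stage)
  ultimately show ?thesis by blast
qed

text \<open>The closure of \<open>A \<alpha>\<close> lies in a later stage, hence is countable; so
  the closed stage of \<open>X\<close> sits inside countably many slices, each a continuous image of
  a Lindelof set.\<close>

lemma type_I_product_countable_left:
  assumes count: "\<And>\<alpha>. countable (A \<alpha>)"
  shows "type_I X XA"
proof (rule type_I_intro)
  show "Hausdorff_space X" by (rule Hausdorff_product)
  show "topspace X = (\<Union>\<alpha>. XA \<alpha>)"
  proof (intro subset_antisym subsetI)
    fix x assume x: "x \<in> topspace X"
    obtain \<alpha> where \<alpha>: "fstX x \<in> A \<alpha>" using type_I_exhaust[OF Y fstX_in[OF x]] .
    obtain \<beta> where \<beta>: "sndX x \<in> B \<beta>" using type_I_exhaust[OF W sndX_in[OF x]] .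
    have "x \<in> XA (max \<alpha> \<beta>)"
      using x \<alpha> \<beta> type_I_mono[OF Y, of \<alpha> "max \<alpha> \<beta>"] type_I_mono[OF W, of \<beta> "max \<alpha> \<beta>"]
      by (auto simp: stage)
    then show "x \<in> (\<Union>\<alpha>. XA \<alpha>)" by blast
  qed (auto simp: stage)
  show "openin X (XA \<alpha>)" for \<alpha>
  proof -
    have "XA \<alpha> = {x \<in> topspace X. fstX x \<in> A \<alpha>} \<inter> {x \<in> topspace X. sndX x \<in> B \<alpha>}"
      by (auto simp: stage)
    moreover have "openin Y (A \<alpha>)" "openin W (B \<alpha>)"
      using Y W by (simp_all add: type_I_def)
    ultimately show ?thesis
      using openin_continuous_map_preimage[OF cont_fst] openin_continuous_map_preimage[OF cont_snd]
      by auto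
  qed
  show "X closure_of XA \<alpha> \<subseteq> XA \<beta>" if "\<alpha> < \<beta>" for \<alpha> \<beta>
    using closure_stage_subset[of \<alpha>] type_I_closure_sub[OF Y that] type_I_closure_sub[OF W that]
    by (auto simp: stage)
  show "Lindelof_space (subtopology X (X closure_of XA \<alpha>))" for \<alpha>
  proof -
    let ?P = "\<lambda>y. pair y ` (W closure_of B \<alpha>)"
    let ?U = "\<Union> (?P ` (Y closure_of A \<alpha>))"
    have clY: "Y closure_of A \<alpha> \<subseteq> topspace Y" and clW: "W closure_of B \<alpha> \<subseteq> topspace W"
      by (simp_all add: closure_of_subset_topspace)
    obtain \<gamma> where "\<alpha> < \<gamma>" using omega1_greater by blast
    then have "countable (Y closure_of A \<alpha>)"
      using type_I_closure_sub[OF Y] count countable_subset by metis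
    moreover have "Lindelof_space (subtopology X (?P y))" if y: "y \<in> Y closure_of A \<alpha>" for y
    proof (rule Lindelof_space_continuous_map_image)
      show "Lindelof_space (subtopology W (W closure_of B \<alpha>))"
        using W by (simp add: type_I_def)
      have yY: "y \<in> topspace Y" using y clY by blast
      show "continuous_map (subtopology W (W closure_of B \<alpha>)) (subtopology X (?P y)) (pair y)"
        using cont_right[OF yY]
        by (auto simp: continuous_map_in_subtopology continuous_map_from_subtopology)
      show "pair y ` topspace (subtopology W (W closure_of B \<alpha>)) = topspace (subtopology X (?P y))"
        using clW pair[OF yY] by auto
    qed
    ultimately have "Lindelof_space (subtopology X ?U)"
      by (intro Lindelof_space_Union) auto
    moreover have sub: "X closure_of XA \<alpha> \<subseteq> ?U"
    proof
      fix x assume "x \<in> X closure_of XA \<alpha>"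
      then have x: "x \<in> topspace X" "fstX x \<in> Y closure_of A \<alpha>" "sndX x \<in> W closure_of B \<alpha>"
        using closure_stage_subset[of \<alpha>] by auto
      have "x = pair (fstX x) (sndX x)"
        using pair_collapse[OF x(1)] by simp
      then show "x \<in> ?U" using x(2,3) by blast
    qed
    moreover have "closedin (subtopology X ?U) (X closure_of XA \<alpha>)"
      unfolding closedin_subtopology
      using sub by (intro exI[of _ "X closure_of XA \<alpha>"]) (simp add: inf.absorb1)
    ultimately show ?thesis
      using Lindelof_space_closedin_subtopology[of "subtopology X ?U" "X closure_of XA \<alpha>"]
      by (simp add: subtopology_subtopology inf.absorb2)
  qed
  show "\<not> bounded_wrt XA (topspace X)"
  proof
    assume "bounded_wrt XA (topspace X)"
    then obtain \<alpha> where \<alpha>: "topspace X \<subseteq> XA \<alpha>" unfolding bounded_wrt_def by blast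
    obtain y where y: "y \<in> topspace Y" "y \<notin> A \<alpha>" using type_I_outside[OF Y] .
    obtain w where w: "w \<in> topspace W" "w \<notin> B \<alpha>" using type_I_outside[OF W] .
    show False using pair[OF y(1) w(1)] \<alpha> y(2) by (auto simp: stage)
  qed
qed

text \<open>\<open>Y\<close> is a retract of \<open>X\<close> through any slice, and retracts
  inherit regularity.\<close>

lemma not_regular_product:
  assumes "\<not> regular_space Y" shows "\<not> regular_space X"
proof -
  obtain w where "w \<in> topspace W" using type_I_outside[OF W] .
  then have "retraction_maps X Y fstX (\<lambda>y. pair y w)"
    unfolding retraction_maps_def using cont_fst cont_left pair by blast
  then show ?thesis
    using assms regular_space_retraction_map_image unfolding retraction_map_def by blast
qed

text \<open>The direction lies below the diagonal: there the first coordinate controls the second one,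
  while the second one stays bounded on the slice of a single point.\<close>

lemma product_direction:
  assumes const: "\<And>f w w'. \<lbrakk>continuous_map W Y f; w \<in> topspace W; w' \<in> topspace W\<rbrakk> \<Longrightarrow> f w = f w'"
    and meet: "\<And>C C'. \<lbrakk>club Y A C; club Y A C'\<rbrakk> \<Longrightarrow> C \<inter> C' \<noteq> {}"
  shows "\<exists>D. club X XA D \<and> true_direction X XA Y A D \<and> \<not> direction X XA W B D"
proof -
  \<comment> \<open>Taking the closure of \<open>B \<beta>\<close> instead of
    \<open>B \<beta>\<close> makes \<open>D\<close> closed: its complement is a union of open
    boxes.\<close>
  define D where "D = {x \<in> topspace X. \<forall>\<beta>. fstX x \<in> A \<beta> \<longrightarrow> sndX x \<in> W closure_of B \<beta>}"
  have memD: "pair y w \<in> D" if "y \<in> topspace Y" "w \<in> B \<gamma>" "y \<notin> A \<gamma>" for y w \<gamma>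
  proof -
    have w: "w \<in> topspace W" using that type_I_stage_subset[OF W] by blast
    have "w \<in> W closure_of B \<beta>" if "y \<in> A \<beta>" for \<beta>
    proof -
      have "\<gamma> \<le> \<beta>"
        using type_I_mono[OF Y, of \<beta> \<gamma>] \<open>y \<notin> A \<gamma>\<close> that by (meson linorder_linear subsetD)
      then show ?thesis
        using type_I_mono[OF W] type_I_sub_closure[OF W] \<open>w \<in> B \<gamma>\<close> by blast
    qed
    then show ?thesis
      using pair[OF that(1) w] by (simp add: D_def)
  qed
  have closed: "closedin X D"
  proof -
    let ?O = "\<lambda>\<beta>. {x \<in> topspace X. fstX x \<in> A \<beta>} \<inter> {x \<in> topspace X. sndX x \<in> topspace W - W closure_of B \<beta>}"
    have "openin X (?O \<beta>)" for \<beta>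
    proof (rule openin_Int)
      show "openin X {x \<in> topspace X. fstX x \<in> A \<beta>}"
        using Y by (intro openin_continuous_map_preimage[OF cont_fst]) (simp add: type_I_def)
      show "openin X {x \<in> topspace X. sndX x \<in> topspace W - W closure_of B \<beta>}"
        by (intro openin_continuous_map_preimage[OF cont_snd]) (simp add: openin_diff)
    qed
    then have "openin X (\<Union>\<beta>. ?O \<beta>)" by blast
    moreover have "topspace X - D = (\<Union>\<beta>. ?O \<beta>)"
      using sndX_in by (auto simp: D_def)
    ultimately show ?thesis
      unfolding closedin_def by (auto simp: D_def)
  qed
  \<comment> \<open>This is the control: on \<open>D\<close> a first coordinate in
    \<open>A \<alpha>\<close> confines the second to the closure of \<open>B \<alpha>\<close>, hence
    the point to any later stage.\<close>
  have unb: "\<not> bounded_wrt A (fstX ` C)" if "C \<subseteq> D" "\<not> bounded_wrt XA C" for C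
  proof
    assume "bounded_wrt A (fstX ` C)"
    then obtain \<alpha> where \<alpha>: "fstX ` C \<subseteq> A \<alpha>" unfolding bounded_wrt_def by blast
    obtain \<beta> where \<beta>: "\<alpha> < \<beta>" using omega1_greater by blast
    have "C \<subseteq> XA \<beta>"
    proof
      fix x assume "x \<in> C"
      then have "x \<in> topspace X" "fstX x \<in> A \<alpha>" "sndX x \<in> W closure_of B \<alpha>"
        using \<alpha> that(1) by (auto simp: D_def)
      then show "x \<in> XA \<beta>"
        using type_I_mono[OF Y less_imp_le[OF \<beta>]] type_I_closure_sub[OF W \<beta>] by (auto simp: stage)
    qed
    with that(2) show False unfolding bounded_wrt_def by blast
  qed
  obtain w0 where w0: "w0 \<in> topspace W" using type_I_outside[OF W] .
  obtain \<gamma>0 where \<gamma>0: "w0 \<in> B \<gamma>0" using type_I_exhaust[OF W w0] .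
  \<comment> \<open>This slice is unbounded, since its points far out in the first coordinate all
    belong to \<open>D\<close>, although \<open>sndX\<close> is constant on it.\<close>
  define C0 where "C0 = D \<inter> {x \<in> topspace X. sndX x \<in> {w0}}"
  have C0: "club X XA C0"
    unfolding club_def
  proof
    have "closedin W {w0}"
      using W w0 by (simp add: closedin_Hausdorff_sing_eq type_I_def)
    then show "closedin X C0"
      unfolding C0_def by (intro closedin_Int closed closedin_continuous_map_preimage[OF cont_snd])
    show "\<not> bounded_wrt XA C0"
    proof
      assume "bounded_wrt XA C0"
      then obtain \<alpha> where \<alpha>: "C0 \<subseteq> XA \<alpha>" unfolding bounded_wrt_def by blast
      obtain y where y: "y \<in> topspace Y" "y \<notin> A (max \<alpha> \<gamma>0)" using type_I_outside[OF Y] .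
      then have y': "y \<notin> A \<alpha>" "y \<notin> A \<gamma>0"
        using type_I_mono[OF Y max.cobounded1[of \<alpha> \<gamma>0]] type_I_mono[OF Y max.cobounded2[of \<gamma>0 \<alpha>]] by auto
      have "pair y w0 \<in> C0"
        using memD[OF y(1) \<gamma>0 y'(2)] pair[OF y(1) w0] by (simp add: C0_def)
      then show False
        using \<alpha> y'(1) pair[OF y(1) w0] by (auto simp: stage)
    qed
  qed
  have C0D: "C0 \<subseteq> D" by (simp add: C0_def)
  have clubD: "club X XA D"
    using closed C0 C0D unfolding club_def bounded_wrt_def by (meson order_trans)
  have "direction X XA Y A D"
    unfolding direction_def
  proof (intro conjI allI impI clubD notI)
    fix f C
    assume f: "continuous_map X Y f \<and> \<not> bounded_wrt A (f ` D)" and C: "club X XA C \<and> C \<subseteq> D"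
      and "bounded_wrt A (f ` C)"
    then obtain \<alpha> where \<alpha>: "f ` C \<subseteq> A \<alpha>" unfolding bounded_wrt_def by blast
    obtain \<beta> where \<beta>: "\<alpha> < \<beta>" using omega1_greater by blast
    \<comment> \<open>By \<open>const\<close>, \<open>f\<close> does not vary while the first
      coordinate is fixed, so it factors as \<open>g\<close> after \<open>fstX\<close>;
      \<open>w0\<close> is merely a reference point.\<close>
    define g where "g y = f (pair y w0)" for y
    have g: "continuous_map Y Y g"
      using continuous_map_compose[OF cont_left[OF w0], of Y f] f
      by (simp add: g_def[abs_def] comp_def)
    have fg: "f x = g (fstX x)" if x: "x \<in> topspace X" for x
    proof -
      have "continuous_map W Y (f \<circ> pair (fstX x))"
        using continuous_map_compose[OF cont_right[OF fstX_in[OF x]]] f by blast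
      from const[OF this sndX_in[OF x] w0] show ?thesis
        using pair_collapse[OF x] by (simp add: g_def)
    qed
    \<comment> \<open>If \<open>f\<close> is bounded on \<open>C\<close> but not on
      \<open>D\<close>, both preimages are clubs of \<open>Y\<close>. They are disjoint because
      \<open>\<alpha> < \<beta>\<close>, against \<open>meet\<close>.\<close>
    define E1 where "E1 = {y \<in> topspace Y. g y \<in> Y closure_of A \<alpha>}"
    define E2 where "E2 = {y \<in> topspace Y. g y \<in> topspace Y - A \<beta>}"
    have "club Y A E1"
      unfolding club_def
    proof
      show "closedin Y E1"
        unfolding E1_def by (intro closedin_continuous_map_preimage[OF g]) simp
      have "fstX ` C \<subseteq> E1"
      proof safe
        fix x assume x: "x \<in> C"
        then have xX: "x \<in> topspace X" using C by (auto simp: D_def)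
        have "f x \<in> Y closure_of A \<alpha>"
          using x \<alpha> type_I_sub_closure[OF Y] by blast
        then show "fstX x \<in> E1"
          using fstX_in[OF xX] fg[OF xX] by (simp add: E1_def)
      qed
      moreover have "\<not> bounded_wrt A (fstX ` C)"
        using unb C by (simp add: club_def)
      ultimately show "\<not> bounded_wrt A E1"
        unfolding bounded_wrt_def by (meson order_trans)
    qed
    moreover have "club Y A E2"
      unfolding club_def
    proof
      have "closedin Y (topspace Y - A \<beta>)"
        using Y by (intro closedin_diff closedin_topspace) (simp add: type_I_def)
      then show "closedin Y E2"
        unfolding E2_def by (rule closedin_continuous_map_preimage[OF g])
      show "\<not> bounded_wrt A E2"
      proof
        assume "bounded_wrt A E2"
        then obtain \<delta> where \<delta>: "E2 \<subseteq> A \<delta>" unfolding bounded_wrt_def by blast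
        \<comment> \<open>Outside \<open>A \<delta>\<close> the values of \<open>g\<close> would lie
          in \<open>A \<beta>\<close>; on the Lindelof set \<open>?K\<close> they are bounded
          anyway. Together this would bound \<open>f\<close> on \<open>D\<close>.\<close>
        let ?K = "Y closure_of A \<delta>"
        have gK: "g ` ?K \<subseteq> topspace Y"
          using continuous_map_image_subset_topspace[OF g] closure_of_subset_topspace[of Y "A \<delta>"] by blast
        have "Lindelof_space (subtopology Y (g ` ?K))"
        proof (rule Lindelof_space_continuous_map_image)
          show "Lindelof_space (subtopology Y ?K)"
            using Y by (simp add: type_I_def)
          show "continuous_map (subtopology Y ?K) (subtopology Y (g ` ?K)) g"
            using g by (auto simp: continuous_map_in_subtopology continuous_map_from_subtopology)
          show "g ` topspace (subtopology Y ?K) = topspace (subtopology Y (g ` ?K))"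
            using gK closure_of_subset_topspace[of Y "A \<delta>"] by (simp add: inf.absorb2)
        qed
        then have "bounded_wrt A (g ` ?K)"
          using Lindelof_imp_bounded[OF Y] gK by blast
        then obtain \<epsilon> where \<epsilon>: "g ` ?K \<subseteq> A \<epsilon>" unfolding bounded_wrt_def by blast
        have "g y \<in> A (max \<beta> \<epsilon>)" if y: "y \<in> topspace Y" for y
        proof (cases "g y \<in> A \<beta>")
          case True
          then show ?thesis using type_I_mono[OF Y, of \<beta> "max \<beta> \<epsilon>"] by auto
        next
          case False
          moreover have "g y \<in> topspace Y"
            using y continuous_map_image_subset_topspace[OF g] by blast
          ultimately have "y \<in> A \<delta>"
            using y \<delta> by (auto simp: E2_def)
          then have "g y \<in> A \<epsilon>"
            using \<epsilon> type_I_sub_closure[OF Y, of \<delta>] by blast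
          then show ?thesis using type_I_mono[OF Y, of \<epsilon> "max \<beta> \<epsilon>"] by auto
        qed
        then have "f ` D \<subseteq> A (max \<beta> \<epsilon>)"
          using fg fstX_in by (auto simp: D_def)
        with f show False unfolding bounded_wrt_def by blast
      qed
    qed
    ultimately have "E1 \<inter> E2 \<noteq> {}" by (rule meet)
    then show False
      using type_I_closure_sub[OF Y \<beta>] by (auto simp: E1_def E2_def)
  qed
  moreover have "\<not> bounded_wrt A (fstX ` D)"
    using unb clubD by (simp add: club_def)
  ultimately have "true_direction X XA Y A D"
    using cont_fst unfolding true_direction_def by blast
  moreover have "\<not> direction X XA W B D"
  proof
    assume dir: "direction X XA W B D"
    \<comment> \<open>Every \<open>w\<close> occurs on \<open>D\<close> next to a far enough first
      coordinate, whereas on \<open>C0\<close> only \<open>w0\<close> occurs.\<close>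
    have "\<not> bounded_wrt B (sndX ` D)"
    proof
      assume "bounded_wrt B (sndX ` D)"
      then obtain \<alpha> where \<alpha>: "sndX ` D \<subseteq> B \<alpha>" unfolding bounded_wrt_def by blast
      obtain w where w: "w \<in> topspace W" "w \<notin> B \<alpha>" using type_I_outside[OF W] .
      obtain \<gamma> where \<gamma>: "w \<in> B \<gamma>" using type_I_exhaust[OF W w(1)] .
      obtain y where y: "y \<in> topspace Y" "y \<notin> A \<gamma>" using type_I_outside[OF Y] .
      have "pair y w \<in> D" using memD[OF y(1) \<gamma> y(2)] .
      then have "w \<in> B \<alpha>" using \<alpha> pair[OF y(1) w(1)] by (metis image_subset_iff)
      with w(2) show False by blast
    qed
    then have "\<not> bounded_wrt B (sndX ` C0)"
      using dir cont_snd C0 C0D unfolding direction_def by blast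
    moreover have "sndX ` C0 \<subseteq> B \<gamma>0"
      using \<gamma>0 by (auto simp: C0_def)
    ultimately show False unfolding bounded_wrt_def by blast
  qed
  ultimately show ?thesis using clubD by blast
qed

end

section \<open>The long ray\<close>

definition lr :: "omega1 \<Rightarrow> real \<Rightarrow> long_ray" where
  "lr \<beta> t = Abs_long_ray (\<beta>, t)"

definition lr_idx :: "long_ray \<Rightarrow> omega1" where
  "lr_idx x = fst (Rep_long_ray x)"

lemma Rep_lr: "t \<in> {0..<1} \<Longrightarrow> Rep_long_ray (lr \<beta> t) = (\<beta>, t)"
  by (simp add: lr_def Abs_long_ray_inverse)

lemma lr_idx_lr: "t \<in> {0..<1} \<Longrightarrow> lr_idx (lr \<beta> t) = \<beta>"
  by (simp add: lr_idx_def Rep_lr)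

lemma lr_cases: obtains \<beta> t where "t \<in> {0..<1}" "x = lr \<beta> t"
proof -
  have "x = lr (fst (Rep_long_ray x)) (snd (Rep_long_ray x))"
    by (simp add: lr_def Rep_long_ray_inverse)
  moreover have "snd (Rep_long_ray x) \<in> {0..<1}"
    using Rep_long_ray[of x] by auto
  ultimately show ?thesis using that by blast
qed

lemma lr_less_iff:
  "s \<in> {0..<1} \<Longrightarrow> t \<in> {0..<1} \<Longrightarrow> lr \<beta> s < lr \<gamma> t \<longleftrightarrow> \<beta> < \<gamma> \<or> \<beta> = \<gamma> \<and> s < t"
  by (simp add: less_long_ray_def Rep_lr)

lemma long_ray_stage_eq: "long_ray_stage \<alpha> = {x. lr_idx x < \<alpha>}"
proof (intro set_eqI)
  fix x show "x \<in> long_ray_stage \<alpha> \<longleftrightarrow> x \<in> {x. lr_idx x < \<alpha>}"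
    using lr_less_iff[of _ 0 _ \<alpha>] unfolding long_ray_stage_def lr_def[symmetric]
    by (cases x rule: lr_cases) (auto simp: lr_idx_lr)
qed

lemma long_ray_dense:
  fixes x y :: long_ray
  assumes "x < y" obtains z where "x < z" "z < y"
proof (cases x rule: lr_cases)
  case x: (1 \<beta> s)
  show ?thesis
  proof (cases y rule: lr_cases)
    case y: (1 \<gamma> t)
    define u where "u = (if \<beta> = \<gamma> then (s + t) / 2 else (s + 1) / 2)"
    have "\<beta> < \<gamma> \<or> \<beta> = \<gamma> \<and> s < t"
      using assms x y by (simp add: lr_less_iff)
    moreover from this have "u \<in> {0..<1}"
      using x y by (auto simp: u_def)
    ultimately have "x < lr \<beta> u" "lr \<beta> u < y"
      using x y by (auto simp: lr_less_iff) (auto simp: u_def split: if_splits)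
    then show ?thesis by (rule that)
  qed
qed

text \<open>Density gives two points \<open>c < d\<close> strictly between \<open>x\<close> and
  \<open>y\<close>; the closed rays ending in \<open>c\<close> and starting in \<open>d\<close> are
  disjoint.\<close>

lemma urysohn_separated_long_ray: "urysohn_separated L\<^sub>0"
proof -
  have *: "\<exists>U V. openin L\<^sub>0 U \<and> openin L\<^sub>0 V \<and> x \<in> U \<and> y \<in> V \<and> disjnt (L\<^sub>0 closure_of U) (L\<^sub>0 closure_of V)"
    if xy: "x < y" for x y :: long_ray
  proof -
    obtain d where d: "x < d" "d < y" using long_ray_dense[OF xy] .
    obtain c where c: "x < c" "c < d" using long_ray_dense[OF d(1)] .
    have "L\<^sub>0 closure_of {..<c} \<subseteq> {..c}" "L\<^sub>0 closure_of {d<..} \<subseteq> {d..}"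
      by (rule closure_of_minimal; force)+
    then have "disjnt (L\<^sub>0 closure_of {..<c}) (L\<^sub>0 closure_of {d<..})"
      using c(2) unfolding disjnt_def by (force dest: leD)
    then show ?thesis
      using c d by (intro exI[of _ "{..<c}"] exI[of _ "{d<..}"]) simp
  qed
  show ?thesis
    unfolding urysohn_separated_def
  proof (intro ballI impI)
    fix x y :: long_ray assume "x \<noteq> y"
    then consider "x < y" | "y < x" by (meson linorder_neqE)
    then show "\<exists>U V. openin L\<^sub>0 U \<and> openin L\<^sub>0 V \<and> x \<in> U \<and> y \<in> V \<and> disjnt (L\<^sub>0 closure_of U) (L\<^sub>0 closure_of V)"
    proof cases
      case 2
      then show ?thesis using *[OF 2] disjnt_sym by metis
    qed (rule *)
  qed
qed

lemma continuous_on_lr: "continuous_on {0..<1} (lr \<beta>)"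
proof (rule continuous_on_generate_topology[OF open_long_ray_def])
  fix B :: "long_ray set"
  assume "B \<in> range (\<lambda>a. {..<a}) \<union> range (\<lambda>a. {a<..})"
  then consider a where "B = {..<a}" | a where "B = {a<..}" by auto
  then show "\<exists>C. open C \<and> C \<inter> {0..<1} = lr \<beta> -` B \<inter> {0..<1}"
  proof cases
    case (1 a)
    show ?thesis
    proof (cases a rule: lr_cases)
      case (1 \<gamma> s)
      show ?thesis
        using \<open>B = {..<a}\<close> 1
        by (intro exI[of _ "if \<beta> < \<gamma> then UNIV else if \<beta> = \<gamma> then {..<s} else {}"])
          (auto simp: lr_less_iff)
    qed
  next
    case (2 a)
    show ?thesis
    proof (cases a rule: lr_cases)
      case (1 \<gamma> s)
      show ?thesis
        using \<open>B = {a<..}\<close> 1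
        by (intro exI[of _ "if \<gamma> < \<beta> then UNIV else if \<beta> = \<gamma> then {s<..} else {}"])
          (auto simp: lr_less_iff)
    qed
  qed
qed

lemma long_ray_closure_stage: "L\<^sub>0 closure_of long_ray_stage \<alpha> \<subseteq> {..lr \<alpha> 0}"
  unfolding long_ray_stage_def lr_def[symmetric] by (rule closure_of_minimal) auto

lemma Lindelof_lr_image: "Lindelof_space (top_of_set (lr \<beta> ` {0..<1}))"
proof (rule Lindelof_space_continuous_map_image)
  show "Lindelof_space (top_of_set ({0..<1} :: real set))"
    unfolding Lindelof_space_subtopology
  proof (intro allI impI)
    fix \<U> :: "real set set" assume \<U>: "(\<forall>U\<in>\<U>. openin euclidean U) \<and> topspace euclidean \<inter> {0..<1} \<subseteq> \<Union>\<U>"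
    then obtain \<V> where "\<V> \<subseteq> \<U>" "countable \<V>" "\<Union>\<V> = \<Union>\<U>"
      using Lindelof[of \<U>] by (metis open_openin)
    with \<U> show "\<exists>V. countable V \<and> V \<subseteq> \<U> \<and> topspace euclidean \<inter> {0..<1} \<subseteq> \<Union>V"
      by (intro exI[of _ \<V>]) simp
  qed
  show "continuous_map (top_of_set {0..<1}) (top_of_set (lr \<beta> ` {0..<1})) (lr \<beta>)"
    using continuous_on_lr by (simp add: continuous_map_in_subtopology)
qed simp

lemma type_I_long_ray: "type_I L\<^sub>0 long_ray_stage"
proof (rule type_I_intro)
  show "Hausdorff_space L\<^sub>0"
    by (rule urysohn_separated_imp_Hausdorff[OF urysohn_separated_long_ray])
  show "topspace L\<^sub>0 = (\<Union>\<alpha>. long_ray_stage \<alpha>)"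
    by (auto simp: long_ray_stage_eq intro: omega1_greater)
  show "openin L\<^sub>0 (long_ray_stage \<alpha>)" for \<alpha>
    by (simp add: long_ray_stage_def)
  show "L\<^sub>0 closure_of long_ray_stage \<alpha> \<subseteq> long_ray_stage \<beta>" if "\<alpha> < \<beta>" for \<alpha> \<beta>
  proof -
    have "lr \<alpha> 0 < lr \<beta> 0" using that by (simp add: lr_less_iff)
    then show ?thesis
      using long_ray_closure_stage[of \<alpha>] unfolding long_ray_stage_def lr_def[symmetric] by auto
  qed
  show "Lindelof_space (subtopology L\<^sub>0 (L\<^sub>0 closure_of long_ray_stage \<alpha>))" for \<alpha>
  proof -
    \<comment> \<open>Countably many levels cover the closed stage, each a continuous image of a
      real interval.\<close>
    let ?U = "\<Union>\<beta>\<in>{..\<alpha>}. lr \<beta> ` {0..<1}"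
    have "countable {..\<alpha>}"
      using countable_lessThan_omega1[of \<alpha>] by (simp add: ivl_disj_un_singleton(2)[symmetric])
    then have L: "Lindelof_space (subtopology L\<^sub>0 ?U)"
      by (intro Lindelof_space_Union) (auto simp: Lindelof_lr_image)
    have "{..lr \<alpha> 0} \<subseteq> ?U"
    proof
      fix x assume x: "x \<in> {..lr \<alpha> 0}"
      obtain \<beta> t where "t \<in> {0..<1}" "x = lr \<beta> t" by (rule lr_cases)
      moreover from this have "\<beta> \<le> \<alpha>"
        using x lr_less_iff[of 0 t \<alpha> \<beta>] by (auto simp: not_less[symmetric])
      ultimately show "x \<in> ?U" by blast
    qed
    with long_ray_closure_stage have sub: "L\<^sub>0 closure_of long_ray_stage \<alpha> \<subseteq> ?U"
      by (rule order_trans)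
    then have "closedin (subtopology L\<^sub>0 ?U) (L\<^sub>0 closure_of long_ray_stage \<alpha>)"
      unfolding closedin_subtopology
      by (intro exI[of _ "L\<^sub>0 closure_of long_ray_stage \<alpha>"]) (simp add: inf.absorb1)
    from Lindelof_space_closedin_subtopology[OF L this] sub show ?thesis
      by (simp add: subtopology_subtopology inf.absorb2)
  qed
  show "\<not> bounded_wrt long_ray_stage (topspace L\<^sub>0)"
  proof
    assume "bounded_wrt long_ray_stage (topspace L\<^sub>0)"
    then obtain \<alpha> where "UNIV \<subseteq> long_ray_stage \<alpha>" unfolding bounded_wrt_def by auto
    then have "lr \<alpha> 0 \<in> long_ray_stage \<alpha>" by blast
    then show False by (simp add: long_ray_stage_eq lr_idx_lr)
  qed
qed

text \<open>A sequence whose levels climb to \<open>l\<close> converges to the first point of level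
  \<open>l\<close>.\<close>

lemma long_ray_clubs_meet:
  assumes "club L\<^sub>0 long_ray_stage C" "club L\<^sub>0 long_ray_stage C'"
  shows "C \<inter> C' \<noteq> {}"
proof (rule clubs_meet[OF type_I_long_ray assms])
  fix b :: "nat \<Rightarrow> omega1" and x :: "nat \<Rightarrow> long_ray" and l
  assume bl: "\<And>k. b k < l" and lim: "\<And>\<gamma>. \<gamma> < l \<Longrightarrow> \<exists>k. \<forall>n\<ge>k. \<gamma> < b n"
    and x: "\<And>k. x k \<in> long_ray_stage (b (Suc k)) - long_ray_stage (b k)"
  have idx: "lr_idx (x k) < l" "b k \<le> lr_idx (x k)" for k
    using x[of k] bl[of "Suc k"] by (auto simp: long_ray_stage_eq)
  have less: "x k < lr l 0" for k
    using idx(1)[of k] by (cases "x k" rule: lr_cases) (simp add: lr_idx_lr lr_less_iff)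
  have "x \<longlonglongrightarrow> lr l 0"
  proof (rule order_tendstoI)
    fix a assume a: "a < lr l 0"
    show "\<forall>\<^sub>F n in sequentially. a < x n"
    proof (cases a rule: lr_cases)
      case (1 \<gamma> s)
      then have "\<gamma> < l" using a by (auto simp: lr_less_iff)
      then obtain k where k: "\<forall>n\<ge>k. \<gamma> < b n" using lim by blast
      have "a < x n" if "n \<ge> k" for n
        using idx(2)[of n] k that 1
        by (cases "x n" rule: lr_cases) (auto simp: lr_idx_lr lr_less_iff)
      then show ?thesis by (rule eventually_sequentiallyI)
    qed
  next
    fix a assume "lr l 0 < a"
    then have "x n < a" for n using less[of n] by simp
    then show "\<forall>\<^sub>F n in sequentially. x n < a" by simp
  qed
  then show "\<exists>y. limitin L\<^sub>0 x y sequentially" by auto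
qed

text \<open>A nondegenerate connected compact Hausdorff space is uncountable.\<close>

lemma continuous_map_interval_const:
  fixes h :: "real \<Rightarrow> 'a"
  assumes h: "continuous_map (top_of_set {a..b}) Z h" and Z: "type_I Z A"
    and count: "\<And>\<alpha>. countable (A \<alpha>)" and xy: "x \<in> {a..b}" "y \<in> {a..b}"
  shows "h x = h y"
proof -
  let ?K = "h ` {a..b}"
  have "compactin Z ?K"
    by (rule image_compactin[OF _ h]) (simp add: compactin_subtopology)
  then have K: "compact_space (subtopology Z ?K)" "?K \<subseteq> topspace Z"
    by (simp_all add: compactin_subspace)
  have "Hausdorff_space (subtopology Z ?K)"
    using Z by (simp add: type_I_def Hausdorff_space_subtopology)
  then have norm: "normal_space (subtopology Z ?K)" "t1_space (subtopology Z ?K)"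
    using K(1) by (simp_all add: compact_Hausdorff_or_regular_imp_normal_space Hausdorff_imp_t1_space)
  have "connectedin Z ?K"
    by (rule connectedin_continuous_map_image[OF h]) (simp add: connectedin_subtopology)
  then have conn: "connected_space (subtopology Z ?K)"
    by (simp add: connectedin_def)
  obtain \<alpha> where "?K \<subseteq> A \<alpha>"
    using Lindelof_imp_bounded[OF Z compact_imp_Lindelof_space[OF K(1)] K(2)]
    unfolding bounded_wrt_def by blast
  then have "countable ?K" using count countable_subset by blast
  \<comment> \<open>By Urysohn's lemma a connected normal T1 space with two points maps onto [0, 1],
    so it has at least continuum many points; a countable one is a singleton.\<close>
  then have "\<not> (UNIV :: real set) \<lesssim> topspace (subtopology Z ?K)"
    using K(2) uncountable_UNIV_real countable_lepoll by (simp add: inf.absorb2) blast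
  then obtain c where "topspace (subtopology Z ?K) \<subseteq> {c}"
    using connected_space_imp_card_ge[OF conn norm] by blast
  then have "?K \<subseteq> {c}" using K(2) by (simp add: inf.absorb2)
  with xy show ?thesis by blast
qed

text \<open>Levels are half-open, so compactness is used on the intervals from 0 to
  \<open>t\<close>; the starting points of levels then carry the value to later levels.\<close>

lemma continuous_map_long_ray_const:
  assumes f: "continuous_map L\<^sub>0 Z f" and Z: "type_I Z A" and count: "\<And>\<alpha>. countable (A \<alpha>)"
  shows "f x = f y"
proof (rule const_of_const_on_fibres[OF f, where idx = lr_idx and base = "\<lambda>\<beta>. lr \<beta> 0"])
  show "Hausdorff_space Z" using Z by (simp add: type_I_def)
  have fib: "f (lr \<beta> t) = f (lr \<beta> 0)" if t: "t \<in> {0..<1}" for \<beta> t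
  proof -
    have "continuous_on {0..t} (lr \<beta>)"
      using t by (intro continuous_on_subset[OF continuous_on_lr]) auto
    then have "continuous_map (top_of_set {0..t}) Z (f \<circ> lr \<beta>)"
      using f by (intro continuous_map_compose[where X' = L\<^sub>0]) simp_all
    from continuous_map_interval_const[OF this Z count, of t 0] t show ?thesis by simp
  qed
  show "f x = f y" if "lr_idx x = lr_idx y" for x y
  proof (cases x rule: lr_cases)
    case x: (1 \<beta> s)
    show ?thesis
    proof (cases y rule: lr_cases)
      case y: (1 \<gamma> t)
      show ?thesis using that x y fib[of s \<beta>] fib[of t \<gamma>] by (simp add: lr_idx_lr)
    qed
  qed
  show "lr \<beta> 0 \<in> topspace L\<^sub>0 \<and> lr_idx (lr \<beta> 0) = \<beta>" for \<beta>
    by (simp add: lr_idx_lr)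
  show "lr \<beta> 0 \<in> L\<^sub>0 closure_of {x \<in> topspace L\<^sub>0. lr_idx x < \<beta>}" if "\<alpha> < \<beta>" for \<alpha> \<beta>
    unfolding in_closure_of
  proof (intro conjI allI impI)
    fix T assume T: "lr \<beta> 0 \<in> T \<and> openin L\<^sub>0 T"
    have "lr \<alpha> 0 < lr \<beta> 0" using that by (simp add: lr_less_iff)
    then obtain c where c: "c < lr \<beta> 0" "{c<..lr \<beta> 0} \<subseteq> T"
      using open_left[of T "lr \<beta> 0" "lr \<alpha> 0"] T by auto
    obtain z where z: "c < z" "z < lr \<beta> 0" using long_ray_dense[OF c(1)] by metis
    have "lr_idx z < \<beta>"
      using z(2) by (cases z rule: lr_cases) (auto simp: lr_less_iff lr_idx_lr)
    moreover have "z \<in> T"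
      using z by (intro subsetD[OF c(2)]) simp
    ultimately show "\<exists>y. y \<in> {x \<in> topspace L\<^sub>0. lr_idx x < \<beta>} \<and> y \<in> T"
      by auto
  qed simp
qed simp_all

section \<open>The Golomb ray\<close>

text \<open>Only the level and the number inside the copy matter, so any carrier with such
  coordinates will do; this permits the coding by sets of reals. Numbers start at 2 because each
  copy lacks 1.\<close>

locale golomb_ray =
  fixes S :: "'a set" and idx :: "'a \<Rightarrow> omega1" and num :: "'a \<Rightarrow> nat"
  assumes bij: "bij_betw (\<lambda>x. (idx x, num x)) S (UNIV \<times> {2..})"
begin

definition pt :: "omega1 \<Rightarrow> nat \<Rightarrow> 'a" where
  "pt \<beta> n = inv_into S (\<lambda>x. (idx x, num x)) (\<beta>, n)"

text \<open>The map \<open>rho i\<close> is the retraction onto the \<open>i\<close>-th copy of the Golomb space: it collapses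
  all earlier copies to the base point \<open>2\<close> and all later ones to the point \<open>1\<close>, which the copy
  itself lacks.  The ray carries the initial topology of these maps, so that \<open>(i, 2)\<close> is a limit
  of the earlier copies.\<close>

definition rho :: "omega1 \<Rightarrow> 'a \<Rightarrow> nat" where
  "rho i x = (if idx x < i then 2 else if i < idx x then 1 else num x)"

definition R :: "'a topology" where
  "R = pullback_topology S (\<lambda>x i. rho i x) (product_topology (\<lambda>_. golomb) UNIV)"

definition stage :: "omega1 \<Rightarrow> 'a set" where
  "stage \<alpha> = {x \<in> S. idx x < \<alpha>}"

lemma pt: assumes "n \<ge> 2" shows "pt \<beta> n \<in> S" "idx (pt \<beta> n) = \<beta>" "num (pt \<beta> n) = n"
proof -
  have "(\<beta>, n) \<in> UNIV \<times> {2..}" using assms by simp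
  then show "pt \<beta> n \<in> S" "idx (pt \<beta> n) = \<beta>" "num (pt \<beta> n) = n"
    using bij_betw_inv_into_right[OF bij] bij_betwE[OF bij_betw_inv_into[OF bij]]
    unfolding pt_def by auto
qed

lemma num_ge: "x \<in> S \<Longrightarrow> num x \<ge> 2"
  using bij_betwE[OF bij] by auto

lemma coord_eqI: "\<lbrakk>x \<in> S; y \<in> S; idx x = idx y; num x = num y\<rbrakk> \<Longrightarrow> x = y"
  using bij_betw_imp_inj_on[OF bij] by (simp add: inj_on_def)

lemma rho_less: "idx x < i \<Longrightarrow> rho i x = 2"
  by (simp add: rho_def)

lemma rho_greater: "i < idx x \<Longrightarrow> rho i x = 1"
  by (auto simp: rho_def)

lemma rho_same: "rho (idx x) x = num x"
  by (simp add: rho_def)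

lemma rho_in: "x \<in> S \<Longrightarrow> rho i x \<in> topspace golomb"
  using num_ge[of x] by (auto simp: rho_def topspace_golomb)

lemma topspace_R: "topspace R = S"
  using rho_in by (auto simp: R_def topspace_pullback_topology)

lemma continuous_map_rho: "continuous_map R golomb (rho i)"
proof -
  have "continuous_map R golomb ((\<lambda>u. u i) \<circ> (\<lambda>x i. rho i x))"
    unfolding R_def by (intro continuous_map_pullback continuous_map_product_projection) simp
  then show ?thesis by (simp add: comp_def)
qed

lemma continuous_map_into_R:
  assumes "\<And>z. z \<in> topspace Z \<Longrightarrow> g z \<in> S" "\<And>i. continuous_map Z golomb (\<lambda>z. rho i (g z))"
  shows "continuous_map Z R g"
  unfolding R_def
  by (rule continuous_map_pullback')
    (use assms in \<open>auto simp: comp_def continuous_map_componentwise_UNIV\<close>)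

lemma neighbourhood_R:
  assumes "openin R T" "x \<in> T"
  obtains F W where "finite F" "\<And>i. openin golomb (W i)" "\<And>i. rho i x \<in> W i"
    "\<And>y. \<lbrakk>y \<in> S; \<And>i. i \<in> F \<Longrightarrow> rho i y \<in> W i\<rbrakk> \<Longrightarrow> y \<in> T"
proof -
  obtain U where U: "openin (product_topology (\<lambda>_. golomb) UNIV) U" "T = (\<lambda>x i. rho i x) -` U \<inter> S"
    using assms(1) unfolding R_def openin_pullback_topology by blast
  then have "(\<lambda>i. rho i x) \<in> U" using assms(2) by simp
  from product_topology_open_contains_basis[OF U(1) this] obtain W where
    W: "(\<lambda>i. rho i x) \<in> (\<Pi>\<^sub>E i\<in>UNIV. W i)" "\<forall>i. openin golomb (W i)"
      "finite {i. W i \<noteq> topspace golomb}" "(\<Pi>\<^sub>E i\<in>UNIV. W i) \<subseteq> U"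
    by blast
  have "y \<in> T" if "y \<in> S" "\<And>i. i \<in> {i. W i \<noteq> topspace golomb} \<Longrightarrow> rho i y \<in> W i" for y
  proof -
    have "rho i y \<in> W i" for i
      using that rho_in[OF that(1), of i] by (cases "W i = topspace golomb") auto
    then have "(\<lambda>i. rho i y) \<in> (\<Pi>\<^sub>E i\<in>UNIV. W i)" by auto
    then have "(\<lambda>i. rho i y) \<in> U" by (rule subsetD[OF W(4)])
    then show ?thesis using U(2) that(1) by simp
  qed
  then show ?thesis
    using that[OF W(3), of W] W(1,2) by (auto simp: PiE_iff)
qed

lemma Hausdorff_R: "Hausdorff_space R"
proof (rule Hausdorff_space_injective_preimage)
  show "Hausdorff_space (product_topology (\<lambda>_ :: omega1. golomb) UNIV)"
    by (simp add: Hausdorff_space_product_topology Hausdorff_golomb)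
  show "continuous_map R (product_topology (\<lambda>_. golomb) UNIV) (\<lambda>x i. rho i x)"
    by (simp add: continuous_map_componentwise_UNIV continuous_map_rho)
  show "inj_on (\<lambda>x i. rho i x) (topspace R)"
  proof (rule inj_onI)
    fix x y assume xy: "x \<in> topspace R" "y \<in> topspace R" and eq: "(\<lambda>i. rho i x) = (\<lambda>i. rho i y)"
    have S: "x \<in> S" "y \<in> S" using xy by (simp_all add: topspace_R)
    have *: "rho (idx x) x = rho (idx x) y" "rho (idx y) x = rho (idx y) y"
      using eq by (simp_all add: fun_eq_iff)
    \<comment> \<open>Were the levels different, the retraction at the lower one would send only the
      higher point to 1, as \<open>num\<close> is at least 2.\<close>
    have "idx x = idx y"
      using * num_ge[OF S(1)] num_ge[OF S(2)] rho_greater[of "idx x" y] rho_greater[of "idx y" x]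
      by (cases "idx x" "idx y" rule: linorder_cases) (auto simp: rho_same)
    moreover from this have "num x = num y"
      using * by (metis rho_same)
    ultimately show "x = y" using coord_eqI S by blast
  qed
qed

lemma countable_stage: "countable (stage \<alpha>)"
proof (rule countable_image_inj_on)
  have "(\<lambda>x. (idx x, num x)) ` stage \<alpha> \<subseteq> {..<\<alpha>} \<times> UNIV"
    by (auto simp: stage_def)
  then show "countable ((\<lambda>x. (idx x, num x)) ` stage \<alpha>)"
    by (rule countable_subset) (intro countable_SIGMA countable_lessThan_omega1, simp)
  show "inj_on (\<lambda>x. (idx x, num x)) (stage \<alpha>)"
    using bij_betw_imp_inj_on[OF bij] by (rule inj_on_subset) (auto simp: stage_def)
qed

lemma type_I_R: "type_I R stage"
proof (rule type_I_intro)
  show "Hausdorff_space R" by (rule Hausdorff_R)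
  show "topspace R = (\<Union>\<alpha>. stage \<alpha>)"
    by (auto simp: topspace_R stage_def intro: omega1_greater)
  show "openin R (stage \<alpha>)" for \<alpha>
  proof -
    \<comment> \<open>The points with \<open>rho \<beta>\<close> different from 1 are those of level
      at most \<open>\<beta>\<close>.\<close>
    have "openin golomb (topspace golomb - {1})"
      using Hausdorff_imp_t1_space[OF Hausdorff_golomb] by (simp add: t1_space_openin_delete_alt)
    then have "openin R {x \<in> topspace R. rho \<beta> x \<in> topspace golomb - {1}}" for \<beta>
      by (rule openin_continuous_map_preimage[OF continuous_map_rho])
    then have "openin R (\<Union>\<beta>\<in>{..<\<alpha>}. {x \<in> topspace R. rho \<beta> x \<in> topspace golomb - {1}})"
      by blast
    moreover have "(\<Union>\<beta>\<in>{..<\<alpha>}. {x \<in> topspace R. rho \<beta> x \<in> topspace golomb - {1}}) = stage \<alpha>"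
    proof (intro subset_antisym subsetI)
      fix x assume x: "x \<in> stage \<alpha>"
      then have "rho (idx x) x \<in> topspace golomb - {1}"
        using num_ge[of x] by (auto simp: rho_def stage_def topspace_golomb)
      then show "x \<in> (\<Union>\<beta>\<in>{..<\<alpha>}. {x \<in> topspace R. rho \<beta> x \<in> topspace golomb - {1}})"
        using x by (auto simp: stage_def topspace_R)
    qed (auto simp: stage_def topspace_R rho_def split: if_splits)
    ultimately show ?thesis by simp
  qed
  show cl: "R closure_of stage \<alpha> \<subseteq> stage \<beta>" if "\<alpha> < \<beta>" for \<alpha> \<beta>
  proof -
    \<comment> \<open>The fibre of \<open>rho \<alpha>\<close> over 2 consists of the levels below
      \<open>\<alpha>\<close> and the base point of level \<open>\<alpha>\<close>, so passing to the
      closure adds at most that point.\<close>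
    have "closedin golomb {2}"
      using Hausdorff_golomb by (simp add: closedin_Hausdorff_sing_eq topspace_golomb)
    then have "R closure_of stage \<alpha> \<subseteq> {x \<in> topspace R. rho \<alpha> x \<in> {2}}"
      by (intro closure_of_minimal closedin_continuous_map_preimage[OF continuous_map_rho])
        (auto simp: stage_def topspace_R rho_def)
    then show ?thesis
      using that by (auto simp: stage_def topspace_R rho_def split: if_splits)
  qed
  show "Lindelof_space (subtopology R (R closure_of stage \<alpha>))" for \<alpha>
  proof (rule countable_imp_Lindelof_space)
    obtain \<beta> where "\<alpha> < \<beta>" using omega1_greater .
    then show "countable (topspace (subtopology R (R closure_of stage \<alpha>)))"
      using cl countable_stage countable_subset[of _ "stage \<beta>"] by simp
  qed
  show "\<not> bounded_wrt stage (topspace R)"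
  proof
    assume "bounded_wrt stage (topspace R)"
    then obtain \<alpha> where "S \<subseteq> stage \<alpha>" unfolding bounded_wrt_def topspace_R by blast
    then have "pt \<alpha> 2 \<in> stage \<alpha>" using pt(1)[of 2 \<alpha>] by auto
    then show False by (simp add: stage_def pt)
  qed
qed

text \<open>If the levels of a sequence climb to \<open>l\<close>, each \<open>rho i\<close> is
  eventually constant along it, with its value at \<open>pt l 2\<close>; a neighbourhood restricts
  only finitely many \<open>i\<close>, so the sequence converges there.\<close>

lemma R_clubs_meet:
  assumes "club R stage C" "club R stage C'"
  shows "C \<inter> C' \<noteq> {}"
proof (rule clubs_meet[OF type_I_R assms])
  fix b :: "nat \<Rightarrow> omega1" and x :: "nat \<Rightarrow> 'a" and l
  assume bl: "\<And>k. b k < l" and lim: "\<And>\<gamma>. \<gamma> < l \<Longrightarrow> \<exists>k. \<forall>n\<ge>k. \<gamma> < b n"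
    and x: "\<And>k. x k \<in> stage (b (Suc k)) - stage (b k)"
  have idx: "x k \<in> S" "idx (x k) < l" "b k \<le> idx (x k)" for k
    using x[of k] bl[of "Suc k"] by (auto simp: stage_def)
  have ev: "\<forall>\<^sub>F n in sequentially. rho i (x n) = rho i (pt l 2)" for i
  proof (cases "i < l")
    case True
    then obtain k where k: "\<forall>n\<ge>k. i < b n" using lim by blast
    have "rho i (x n) = rho i (pt l 2)" if "n \<ge> k" for n
    proof -
      have "i < idx (x n)" using k that idx(3)[of n] by (meson order_less_le_trans)
      then show ?thesis using True by (simp add: rho_greater pt)
    qed
    then show ?thesis by (rule eventually_sequentiallyI)
  next
    case False
    have "rho i (x n) = rho i (pt l 2)" for n
    proof -
      have "idx (x n) < i" using False idx(2)[of n] by simp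
      then show ?thesis using False by (simp add: rho_def pt)
    qed
    then show ?thesis by simp
  qed
  have "limitin R x (pt l 2) sequentially"
    unfolding limitin_def
  proof (intro conjI allI impI)
    show "pt l 2 \<in> topspace R" by (simp add: topspace_R pt)
    fix T assume "openin R T \<and> pt l 2 \<in> T"
    then obtain F W where FW: "finite F" "\<And>i. rho i (pt l 2) \<in> W i"
      "\<And>y. \<lbrakk>y \<in> S; \<And>i. i \<in> F \<Longrightarrow> rho i y \<in> W i\<rbrakk> \<Longrightarrow> y \<in> T"
      by (metis neighbourhood_R)
    have "\<forall>\<^sub>F n in sequentially. \<forall>i\<in>F. rho i (x n) = rho i (pt l 2)"
      using FW(1) ev by (simp add: eventually_ball_finite)
    then show "\<forall>\<^sub>F n in sequentially. x n \<in> T"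
      by (rule eventually_mono) (simp add: FW(2,3) idx(1))
  qed
  then show "\<exists>y. limitin R x y sequentially" by blast
qed

section \<open>Rigidity, non-regularity and connectedness of the ray\<close>

lemma continuous_map_pt: "continuous_map (subtopology golomb {2..}) R (pt \<beta>)"
proof (rule continuous_map_into_R)
  show "continuous_map (subtopology golomb {2..}) golomb (\<lambda>n. rho i (pt \<beta> n))" for i
  proof (cases "i = \<beta>")
    case True
    have "continuous_map (subtopology golomb {2..}) golomb (\<lambda>n. n)"
      by (intro continuous_map_from_subtopology continuous_map_id[unfolded id_def])
    then show ?thesis
      by (rule continuous_map_eq) (auto simp: rho_def pt True)
  next
    case False
    have "continuous_map (subtopology golomb {2..}) golomb (\<lambda>n. if \<beta> < i then 2 else 1)"
      by (simp add: topspace_golomb)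
    then show ?thesis
      by (rule continuous_map_eq) (use False in \<open>auto simp: rho_def pt\<close>)
  qed
qed (simp add: pt)

text \<open>The Golomb space makes \<open>f\<close> constant on each copy, and each base point after
  the first is a limit of earlier copies.\<close>

lemma continuous_map_R_const:
  assumes f: "continuous_map R Z f" and Z: "urysohn_separated Z" and xy: "x \<in> S" "y \<in> S"
  shows "f x = f y"
proof (rule const_of_const_on_fibres[OF f, where idx = idx and base = "\<lambda>\<beta>. pt \<beta> 2"])
  show "Hausdorff_space Z" using Z by (rule urysohn_separated_imp_Hausdorff)
  show "x \<in> topspace R" "y \<in> topspace R" using xy by (simp_all add: topspace_R)
  show "f u = f v" if "u \<in> topspace R" "v \<in> topspace R" "idx u = idx v" for u v
  proof -
    have S: "u \<in> S" "v \<in> S" using that by (simp_all add: topspace_R)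
    have "(f \<circ> pt (idx u)) (num u) = (f \<circ> pt (idx u)) (num v)"
      using continuous_map_golomb_const[OF continuous_map_compose[OF continuous_map_pt f] Z]
        num_ge S by blast
    moreover have "pt (idx u) (num u) = u" "pt (idx u) (num v) = v"
      using S that(3) num_ge by (auto intro!: coord_eqI simp: pt)
    ultimately show ?thesis by simp
  qed
  show "pt \<beta> 2 \<in> topspace R \<and> idx (pt \<beta> 2) = \<beta>" for \<beta>
    by (simp add: topspace_R pt)
  show "pt \<beta> 2 \<in> R closure_of {x \<in> topspace R. idx x < \<beta>}" if \<alpha>: "\<alpha> < \<beta>" for \<alpha> \<beta>
    unfolding in_closure_of
  proof (intro conjI allI impI)
    show "pt \<beta> 2 \<in> topspace R" by (simp add: topspace_R pt)
    fix T assume "pt \<beta> 2 \<in> T \<and> openin R T"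
    then obtain F W where FW: "finite F" "\<And>i. openin golomb (W i)" "\<And>i. rho i (pt \<beta> 2) \<in> W i"
      "\<And>y. \<lbrakk>y \<in> S; \<And>i. i \<in> F \<Longrightarrow> rho i y \<in> W i\<rbrakk> \<Longrightarrow> y \<in> T"
      by (metis neighbourhood_R)
    \<comment> \<open>Below \<open>\<beta>\<close> the base point has retraction value 1, but a
      point of copy \<open>m\<close> has value 2 at every index above \<open>m\<close>. So
      \<open>m\<close> must dominate all constrained indices below \<open>\<beta>\<close>; inserting
      \<open>\<alpha>\<close> covers the case that there are none.\<close>
    define m where "m = Max (insert \<alpha> {i \<in> F. i < \<beta>})"
    have "m \<in> insert \<alpha> {i \<in> F. i < \<beta>}"
      unfolding m_def using FW(1) by (intro Max_in) auto
    then have m: "m < \<beta>" using \<alpha> by auto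
    have mge: "i \<le> m" if "i \<in> F" "i < \<beta>" for i
      unfolding m_def using FW(1) that by (intro Max_ge) auto
    have "1 \<in> W m" using FW(3)[of m] m rho_greater[of m "pt \<beta> 2"] by (simp add: pt)
    moreover have "golomb_open (W m)" using FW(2) by (simp add: openin_golomb)
    ultimately obtain c where c: "c > 0" "\<And>n. 1 + c * n \<in> W m"
      using golomb_openD by metis
    \<comment> \<open>A number of the neighbourhood \<open>W m\<close> of 1 other than 1 itself,
      which the copy lacks.\<close>
    define k where "k = 1 + c * 1"
    have k: "k \<in> W m" "k \<ge> 2" using c(2)[of 1] c(1) by (simp_all add: k_def)
    have "rho i (pt m k) \<in> W i" if i: "i \<in> F" for i
    proof (cases "i = m")
      case True
      then show ?thesis using k by (simp add: rho_def pt)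
    next
      case False
      have "rho i (pt m k) = rho i (pt \<beta> 2)"
      proof (cases "i < \<beta>")
        case True
        then have "i < m" using mge[OF i] False by simp
        then show ?thesis using True k(2) by (simp add: rho_greater pt)
      next
        case False
        then have "rho i (pt \<beta> 2) = 2"
          by (cases "i = \<beta>") (simp_all add: rho_def pt)
        moreover have "rho i (pt m k) = 2"
          using False m k(2) by (intro rho_less) (simp add: pt)
        ultimately show ?thesis by simp
      qed
      then show ?thesis using FW(3)[of i] by simp
    qed
    then have "pt m k \<in> T" using FW(4) pt k(2) by blast
    then show "\<exists>y. y \<in> {x \<in> topspace R. idx x < \<beta>} \<and> y \<in> T"
      using pt[OF k(2), of m] m by (auto simp: topspace_R)
  qed
qed

lemma two_points: "\<exists>x\<in>S. \<exists>y\<in>S. x \<noteq> y"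
proof -
  have "num (pt undefined 2) \<noteq> num (pt undefined 3)" by (simp add: pt)
  then show ?thesis using pt(1)[of 2] pt(1)[of 3] by (metis Suc_1 Suc_leD numeral_3_eq_3 order_refl numeral_2_eq_2)
qed

text \<open>Otherwise \<open>R\<close> would itself be a Urysohn-separated target and its identity
  map constant.\<close>

lemma not_regular_R: "\<not> regular_space R"
proof
  assume "regular_space R"
  then have "urysohn_separated R"
    using Hausdorff_R by (rule regular_Hausdorff_imp_urysohn_separated)
  from continuous_map_R_const[OF continuous_map_id this] two_points show False
    by auto
qed

text \<open>The indicator of a clopen set is a continuous map into a discrete space, hence
  constant.\<close>

lemma connected_R: "connected_space R"
  unfolding connected_space_clopen_in
proof (intro allI impI)
  fix T assume T: "openin R T \<and> closedin R T"
  have "continuous_map R (discrete_topology UNIV) (\<lambda>x. x \<in> T)"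
    unfolding continuous_map
  proof (intro conjI allI impI)
    fix U :: "bool set"
    have "T \<subseteq> topspace R" using T closedin_subset by blast
    moreover have "(x \<in> T) \<in> U \<longleftrightarrow> (if x \<in> T then True \<in> U else False \<in> U)" for x
      by simp
    ultimately have "{x \<in> topspace R. (x \<in> T) \<in> U} = (if True \<in> U then T else {}) \<union> (if False \<in> U then topspace R - T else {})"
      by auto
    then show "openin R {x \<in> topspace R. (x \<in> T) \<in> U}"
      using T by (simp add: openin_diff openin_Un)
  qed simp
  from continuous_map_R_const[OF this urysohn_separated_discrete] show "T = {} \<or> T = topspace R"
    using closedin_subset[of R T] T unfolding topspace_R by blast
qed

end

section \<open>Coding by sets of reals\<close>

lemma inj_omega1_real: "\<exists>f :: omega1 \<Rightarrow> real. inj f"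
proof -
  include cardinal_syntax
  have "\<not> |UNIV :: real set| \<le>o natLeq"
    using uncountable_UNIV_real by (simp add: countable_card_le_natLeq)
  then have "natLeq <o |UNIV :: real set|"
    by (simp add: not_ordLeq_iff_ordLess natLeq_Well_order card_of_Well_order)
  then have "cardSuc natLeq \<le>o |UNIV :: real set|"
    by (simp add: cardSuc_least natLeq_Card_order card_of_Card_order)
  moreover have "|Field (cardSuc natLeq)| =o cardSuc natLeq"
    by (simp add: card_of_Field_ordIso cardSuc_Card_order natLeq_Card_order)
  ultimately have "|Field (cardSuc natLeq)| \<le>o |UNIV :: real set|"
    using ordIso_ordLeq_trans by blast
  then obtain h :: "nat set \<Rightarrow> real" where h: "inj_on h (Field (cardSuc natLeq))"
    unfolding card_of_ordLeq[symmetric] by blast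
  have "inj (h \<circ> Rep_omega1)"
    using h Rep_omega1 by (intro comp_inj_on inj_on_subset[OF h]) (auto simp: inj_on_def Rep_omega1_inject)
  then show ?thesis by blast
qed

lemma inj_square_infinite:
  assumes "infinite (UNIV :: 'a set)"
  shows "\<exists>f :: 'a \<times> 'a \<Rightarrow> 'a. inj f"
proof -
  include cardinal_syntax
  have "|(UNIV :: 'a set) \<times> (UNIV :: 'a set)| =o |UNIV :: 'a set|"
    using card_of_Times_same_infinite[OF assms] .
  then obtain f :: "'a \<times> 'a \<Rightarrow> 'a" where "bij_betw f (UNIV \<times> UNIV) UNIV"
    unfolding card_of_ordIso[symmetric] by blast
  then show ?thesis
    by (auto simp: bij_betw_def)
qed

lemma inj_omega1_nat: "\<exists>e :: omega1 \<times> nat \<Rightarrow> real set. inj e"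
proof -
  obtain f :: "omega1 \<Rightarrow> real" where f: "inj f" using inj_omega1_real by blast
  obtain g :: "real \<times> real \<Rightarrow> real" where g: "inj g"
    using inj_square_infinite[OF infinite_UNIV_char_0] by blast
  have "inj (\<lambda>p. {g (f (fst p), real (snd p))})"
    by (rule injI) (simp add: inj_eq[OF f] inj_eq[OF g] prod_eq_iff)
  then show ?thesis by blast
qed

text \<open>A point of the long ray is coded by one real, taken as a singleton, and then paired with
  the given set inside the infinite type of sets of reals.\<close>

lemma inj_set_long_ray: "\<exists>d :: real set \<times> long_ray \<Rightarrow> real set. inj d"
proof -
  obtain f :: "omega1 \<Rightarrow> real" where f: "inj f" using inj_omega1_real by blast
  obtain g :: "real \<times> real \<Rightarrow> real" where g: "inj g"
    using inj_square_infinite[OF infinite_UNIV_char_0] by blast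
  have "infinite (UNIV :: real set set)"
    by (simp add: Finite_Set.finite_set infinite_UNIV_char_0)
  from inj_square_infinite[OF this]
  obtain h :: "real set \<times> real set \<Rightarrow> real set" where h: "inj h" by blast
  have "inj (\<lambda>p. h (fst p, {g (f (fst (Rep_long_ray (snd p))), snd (Rep_long_ray (snd p)))}))"
    by (rule injI)
      (simp add: inj_eq[OF f] inj_eq[OF g] inj_eq[OF h] Rep_long_ray_inject[symmetric] prod_eq_iff)
  then show ?thesis by blast
qed

section \<open>Assembly of the two spaces and their directions\<close>

theorem theorem10p3:
  shows "\<exists>(R :: real set topology) (RA :: omega1 \<Rightarrow> real set set)
          (X :: real set topology) (XA :: omega1 \<Rightarrow> real set set).
     type_I R RA \<and> \<not> regular_space R \<and> connected_space R \<and>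
     type_I X XA \<and> \<not> regular_space X \<and>
     (direction R RA L\<^sub>0 long_ray_stage (topspace R) \<and>
      \<not> true_direction R RA L\<^sub>0 long_ray_stage (topspace R) \<and>
      (\<forall>f. continuous_map R L\<^sub>0 f \<longrightarrow> (\<exists>c. \<forall>x\<in>topspace R. f x = c))) \<and>
     (\<exists>D1 D2.
        club X XA D1 \<and> club X XA D2 \<and>
        true_direction X XA L\<^sub>0 long_ray_stage D1 \<and> \<not> direction X XA R RA D1 \<and>
        true_direction X XA R RA D2 \<and> \<not> direction X XA L\<^sub>0 long_ray_stage D2)"
proof -
  obtain e :: "omega1 \<times> nat \<Rightarrow> real set" where e: "inj e"
    using inj_omega1_nat by blast
  obtain d :: "real set \<times> long_ray \<Rightarrow> real set" where d: "inj d"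
    using inj_set_long_ray by blast
  define S where "S = e ` (UNIV \<times> {2..})"
  have bij: "bij_betw (\<lambda>x. (fst (inv e x), snd (inv e x))) S (UNIV \<times> {2..})"
    using e by (auto simp: bij_betw_def S_def inj_on_def image_image)
  interpret G: golomb_ray S "\<lambda>x. fst (inv e x)" "\<lambda>x. snd (inv e x)"
    by unfold_locales (rule bij)
  define R where "R = G.R"
  define RA where "RA = G.stage"
  have R: "type_I R RA" and S: "topspace R = S"
    unfolding R_def RA_def by (rule G.type_I_R, rule G.topspace_R)
  have R_const: "f x = f y" if "continuous_map R L\<^sub>0 f" "x \<in> topspace R" "y \<in> topspace R" for f x y
    using G.continuous_map_R_const[OF _ urysohn_separated_long_ray] that
    unfolding R_def G.topspace_R by blast
  define P where "P = prod_topology R L\<^sub>0"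
  define XS where "XS = d ` (topspace R \<times> UNIV)"
  \<comment> \<open>Since \<open>d\<close> is injective, this is a homeomorphic copy of the product
    on sets of reals.\<close>
  define X where "X = pullback_topology XS (inv d) P"
  define p where "p x = fst (inv d x)" for x
  define q where "q x = snd (inv d x)" for x
  define XA where "XA \<alpha> = {x \<in> topspace X. p x \<in> RA \<alpha> \<and> q x \<in> long_ray_stage \<alpha>}" for \<alpha>
  have inv_d: "inv d (d u) = u" for u using d by simp
  have topX: "topspace X = XS"
    by (auto simp: X_def topspace_pullback_topology P_def XS_def inv_d)
  have into_X: "continuous_map Z X (\<lambda>z. d (g z))" if g: "continuous_map Z P g" for Z :: "'z topology" and g
    unfolding X_def
  proof (rule continuous_map_pullback')
    show "continuous_map Z P (inv d \<circ> (\<lambda>z. d (g z)))"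
      using g by (simp add: comp_def inv_d)
    show "topspace Z \<subseteq> (\<lambda>z. d (g z)) -` XS"
      using continuous_map_image_subset_topspace[OF g] by (auto simp: XS_def P_def)
  qed
  interpret XP: type_I_product X XA R RA L\<^sub>0 long_ray_stage p q "\<lambda>y w. d (y, w)"
  proof
    show "type_I R RA" by (rule R)
    show "type_I L\<^sub>0 long_ray_stage" by (rule type_I_long_ray)
    show "XA \<alpha> = {x \<in> topspace X. p x \<in> RA \<alpha> \<and> q x \<in> long_ray_stage \<alpha>}" for \<alpha>
      by (rule XA_def)
    have "continuous_map X R (fst \<circ> inv d)" "continuous_map X L\<^sub>0 (snd \<circ> inv d)"
      unfolding X_def P_def
      by (rule continuous_map_pullback, rule continuous_map_fst, rule continuous_map_pullback, rule continuous_map_snd)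
    then show "continuous_map X R p" "continuous_map X L\<^sub>0 q"
      by (simp_all add: p_def[abs_def] q_def[abs_def] comp_def)
    show "d (y, w) \<in> topspace X \<and> p (d (y, w)) = y \<and> q (d (y, w)) = w"
      if "y \<in> topspace R" for y w
      using that by (auto simp: topX XS_def p_def q_def inv_d)
    show "d (p x, q x) = x" if "x \<in> topspace X" for x
      using that by (auto simp: topX XS_def p_def q_def inv_d)
    show "continuous_map R X (\<lambda>y. d (y, w))" for w
      by (rule into_X) (simp add: P_def continuous_map_paired)
    show "continuous_map L\<^sub>0 X (\<lambda>w. d (y, w))" if "y \<in> topspace R" for y
      using that by (intro into_X) (simp add: P_def continuous_map_paired)
  qed
  have R_bounded: "bounded_wrt long_ray_stage (f ` topspace R)" if f: "continuous_map R L\<^sub>0 f" for f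
  proof -
    obtain x where x: "x \<in> topspace R" using type_I_outside[OF R] .
    obtain \<alpha> where "f x \<in> long_ray_stage \<alpha>"
      using type_I_exhaust[OF type_I_long_ray, of "f x"] by auto
    then have "f ` topspace R \<subseteq> long_ray_stage \<alpha>"
      using R_const[OF f _ x] by auto
    then show ?thesis unfolding bounded_wrt_def by blast
  qed
  \<comment> \<open>The direction property holds vacuously, as no continuous map into the long ray
    is unbounded; for the same reason it is not true.\<close>
  have "direction R RA L\<^sub>0 long_ray_stage (topspace R)"
    "\<not> true_direction R RA L\<^sub>0 long_ray_stage (topspace R)"
    using R_bounded type_I_unbounded[OF R]
    by (auto simp: direction_def true_direction_def club_def)
  moreover have "\<exists>c. \<forall>x\<in>topspace R. f x = c" if "continuous_map R L\<^sub>0 f" for f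
    using R_const[OF that] by blast
  moreover have "\<not> regular_space R" "connected_space R"
    unfolding R_def by (rule G.not_regular_R, rule G.connected_R)
  moreover from this have "\<not> regular_space X"
    using XP.not_regular_product by blast
  moreover have "type_I X XA"
    using XP.type_I_product_countable_left G.countable_stage unfolding RA_def by blast
  moreover have "\<exists>D. club X XA D \<and> true_direction X XA R RA D \<and> \<not> direction X XA L\<^sub>0 long_ray_stage D"
  proof (rule XP.product_direction)
    show "f w = f w'" if "continuous_map L\<^sub>0 R f" for f w w'
      using continuous_map_long_ray_const[OF that R] G.countable_stage unfolding RA_def by blast
    show "C \<inter> C' \<noteq> {}" if "club R RA C" "club R RA C'" for C C'
      using G.R_clubs_meet that unfolding R_def RA_def by blast
  qed
  \<comment> \<open>With the factors interchanged, the long ray coordinate controls the other one: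
    now maps from \<open>R\<close> to the long ray must be constant and clubs of the long ray must
    meet.\<close>
  moreover have "\<exists>D. club X XA D \<and> true_direction X XA L\<^sub>0 long_ray_stage D \<and> \<not> direction X XA R RA D"
    by (rule type_I_product.product_direction[OF XP.swap R_const long_ray_clubs_meet])
  ultimately show ?thesis
    using R by blast
qed

end
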